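(* Let $p$ be a prime number, and let $q=p$ if $p$ is odd and $q=4$ if $p=2$. Let $\chi$ be an even Dirichlet character of conductor $f$, and let $c>1$ be an integer satisfying $(c,pf)=1$. Then for $s\in\mathbb{C}_p$ with $|s|<qp^{-1/(p-1)}$, $$-(1-\chi(c)\langle c\rangle^{1-s})\,L_p(s,\chi)=\lim_{n\to\infty}\sum_{\substack{a=1\\ p\nmid a}}^{fp^n}\chi\omega^{-1}(a)\,\frac{\epsilon_{a,c,fp^n}}{\langle a\rangle^{s}}.$$
   Context: $|\cdot|$ is the absolute value on $\mathbb{C}_p$ with $|p|=1/p$, and the limit is taken in $\mathbb{C}_p$. Dirichlet characters are primitive and take values in $\mathbb{C}_p$ (via a fixed embedding of $\overline{\mathbb{Q}}$), with $\chi(a)=0$ if $(a,f)>1$. $\omega$ is the Teichmüller character of conductor $q$: for $p\nmid a$, $\omega(a)$ is the root of unity in $\mathbb{Z}_p$ (of order dividing $p-1$ if $p$ is odd, $\pm1$ if $p=2$) with $\omega(a)\equiv a \bmod q$. For $p\nmid a$, $\langle a\rangle=a/\omega(a)\in 1+q\mathbb{Z}_p$, $\chi\omega^{-1}(a)=\chi(a)\omega(a)^{-1}$, and $\langle a\rangle^{s}=\sum_{j\ge0}\binom{s}{j}(\langle a\rangle-1)^j$ for $|s|<qp^{-1/(p-1)}$. The $p$-adic $L$-function $L_p(s,\chi)$ is the meromorphic function (analytic if $\chi\ne1$) on $\{s\in\mathbb{C}_p: |s|<qp^{-1/(p-1)}\}$ given explicitly, for any positive multiple $F$ of $q$ and $f$,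 by $L_p(s,\chi)=\frac1F\frac1{s-1}\sum_{1\le a\le F,\,p\nmid a}\chi(a)\langle a\rangle^{1-s}\sum_{j\ge0}\binom{1-s}{j}(F/a)^jB_j$, where $B_j$ are the Bernoulli numbers ($B_1=-1/2$). For a positive integer $m$, $\{x\}_m$ denotes the unique representative of $x$ modulo $m$ in $\{0,1,\dots,m-1\}$. For integers $a$, $c>1$ and $F\geq 1$ with $(c,F)=1$, $\epsilon_{a,c,F}=\frac{c-1}{2}-\{-aF^{-1}\}_c$, where $F^{-1}$ is the inverse of $F$ modulo $c$. *)

theory Defs
  imports
    "HOL-Analysis.Analysis"
    "HOL-Computational_Algebra.Computational_Algebra"
    "HOL-Number_Theory.Modular_Inverse"
begin

subsection \<open>The field of complex p-adic numbers\<close>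

text \<open>
  The library has no p-adic numbers.  A model of the completion of an algebraic closure of the
  p-adic numbers is a type in the class below that satisfies \<open>complex_padic\<close>; these
  properties determine it up to isometric isomorphism.  Since the metric is induced by the
  absolute value \<open>nabs\<close>, limits and infinite series are the library's.  (The library's \<open>norm\<close> is
  not usable here: its type is constrained to real normed vector spaces.)
\<close>

class nonarch_complete_field = field_char_0 + complete_space +
  fixes nabs :: "'a \<Rightarrow> real"
  assumes dist_nabs: "dist x y = nabs (x - y)"
    and nabs_mult: "nabs (x * y) = nabs x * nabs y"
    and nabs_add: "nabs (x + y) \<le> max (nabs x) (nabs y)"

text \<open>When the absolute value of \<open>p\<close> is \<open>1/p\<close>, these closures are the p-adic integers and the p-adic numbers.\<close>

definition padic_ints :: "'a::nonarch_complete_field set" where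
  "padic_ints = closure \<int>"

definition padic_nums :: "'a::nonarch_complete_field set" where
  "padic_nums = closure \<rat>"

definition padic_algebraic :: "'a::nonarch_complete_field set" where
  "padic_algebraic =
     {x. \<exists>P. P \<noteq> 0 \<and> (\<forall>i. coeff P i \<in> padic_nums) \<and> poly P x = 0}"

text \<open>
  The conditions: \<open>nabs\<close> extends the p-adic absolute value normalised by \<open>|p| = 1/p\<close>, the
  algebraic elements over the p-adic numbers form an algebraically closed field, and the whole
  (complete) field is the completion of that subfield.
\<close>

definition complex_padic :: "nat \<Rightarrow> 'a::nonarch_complete_field itself \<Rightarrow> bool" where
  "complex_padic p K \<longleftrightarrow>
     nabs (of_nat p :: 'a) = 1 / real p \<and>
     (\<forall>P :: 'a poly. (\<forall>i. coeff P i \<in> padic_algebraic) \<and> degree P > 0 \<longrightarrow>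
        (\<exists>x \<in> padic_algebraic. poly P x = 0)) \<and>
     closure (padic_algebraic :: 'a set) = UNIV"

definition qq :: "nat \<Rightarrow> nat" where
  "qq p = (if p = 2 then 4 else p)"

subsection \<open>Characters\<close>

text \<open>
  Primitivity: the character is not trivial on the units congruent to 1 modulo a proper divisor
  of \<open>f\<close>, so that \<open>f\<close> is its conductor.  The trivial character has \<open>f = 1\<close> and is constantly 1.
\<close>

definition primitive_dirichlet_character :: "nat \<Rightarrow> (int \<Rightarrow> 'a::field) \<Rightarrow> bool" where
  "primitive_dirichlet_character f chi \<longleftrightarrow>
     f > 0 \<and>
     (\<forall>a b. chi (a * b) = chi a * chi b) \<and>
     (\<forall>a. chi (a + int f) = chi a) \<and>
     (\<forall>a. chi a = 0 \<longleftrightarrow> \<not> coprime a (int f)) \<and>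
     (\<forall>d. d dvd f \<and> d < f \<longrightarrow>
        (\<exists>a. coprime a (int f) \<and> [a = 1] (mod int d) \<and> chi a \<noteq> 1))"

definition even_character :: "(int \<Rightarrow> 'a::field) \<Rightarrow> bool" where
  "even_character chi \<longleftrightarrow> chi (-1) = 1"

definition teichmuller :: "nat \<Rightarrow> int \<Rightarrow> 'a::nonarch_complete_field" where
  "teichmuller p a =
     (if int p dvd a then 0
      else (THE z. z \<in> padic_ints \<and> z ^ (if p = 2 then 2 else p - 1) = 1 \<and>
                   (\<exists>y \<in> padic_ints. z - of_int a = of_nat (qq p) * y)))"

text \<open>\<open>angle p a\<close> is the quantity usually written as \<open>a\<close> in angle brackets.\<close>

definition angle :: "nat \<Rightarrow> int \<Rightarrow> 'a::nonarch_complete_field" where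
  "angle p a = of_int a / teichmuller p a"

definition twist_inv :: "nat \<Rightarrow> (int \<Rightarrow> 'a::nonarch_complete_field) \<Rightarrow> int \<Rightarrow> 'a" where
  "twist_inv p chi a = chi a * inverse (teichmuller p a)"

definition angle_pow :: "nat \<Rightarrow> int \<Rightarrow> 'a::nonarch_complete_field \<Rightarrow> 'a" where
  "angle_pow p a s = (\<Sum>j. (s gchoose j) * (angle p a - 1) ^ j)"

subsection \<open>The p-adic L-function\<close>

text \<open>Defined by the generating function \<open>X / (exp X - 1)\<close>, so the value at 1 is \<open>-1/2\<close>.\<close>

definition bernoulli_number :: "nat \<Rightarrow> rat" where
  "bernoulli_number j = fact j * fps_nth (fps_X / (fps_exp 1 - 1)) j"

definition padic_L_formula ::
  "nat \<Rightarrow> (int \<Rightarrow> 'a::nonarch_complete_field) \<Rightarrow> nat \<Rightarrow> 'a \<Rightarrow> 'a" where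
  "padic_L_formula p chi F s =
     1 / of_nat F * (1 / (s - 1)) *
     (\<Sum>a | 1 \<le> a \<and> a \<le> int F \<and> \<not> int p dvd a.
        chi a * angle_pow p a (1 - s) *
        (\<Sum>j. ((1 - s) gchoose j) * (of_nat F / of_int a) ^ j * of_rat (bernoulli_number j)))"

text \<open>
  The common value of the formula over all positive multiples \<open>F\<close> of \<open>qq p\<close> and the conductor \<open>f\<close>.
  At \<open>s = 1\<close>, where the formula divides by zero, the value of the analytic function is the limit
  of the formula; for the trivial character there is a pole, and the value at 1 is meaningless.
\<close>

definition padic_L ::
  "nat \<Rightarrow> nat \<Rightarrow> (int \<Rightarrow> 'a::nonarch_complete_field) \<Rightarrow> 'a \<Rightarrow> 'a" where
  "padic_L p f chi s =
     (THE y. \<forall>F. F > 0 \<and> qq p dvd F \<and> f dvd F \<longrightarrow>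
        (if s = 1 then (padic_L_formula p chi F \<longlongrightarrow> y) (at 1)
         else y = padic_L_formula p chi F s))"

subsection \<open>The numbers epsilon\<close>

definition eps :: "int \<Rightarrow> int \<Rightarrow> int \<Rightarrow> rat" where
  "eps a c F = (of_int c - 1) / 2 - of_int ((- a * modular_inverse c F) mod c)"

end

theory Submission
  imports Defs "HOL-Number_Theory.Residues"
begin

text \<open>
  Write \<open>u = 1 - s\<close>.  Expanding each power as a binomial series, the L-function is a Volkenborn
  integral: since the means of \<open>x\<^sup>j\<close> over \<open>{0..<N}\<close> tend to the Bernoulli number \<open>B\<^sub>j\<close> as
  \<open>N\<close> tends to 0 p-adically, \<open>- u L(s)\<close> is the limit of the means
  \<open>W(M) = (1/M) (\<Sum>a\<le>M. chi(a) \<langle>a\<rangle>\<^sup>u)\<close> over \<open>a\<close> prime to \<open>p\<close>, whatever the multiple \<open>F\<close>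
  in the formula.
  Multiplication by \<open>c\<close> permutes the residues modulo \<open>M\<close>: \<open>c a = b + M k\<close> with
  \<open>k = {-b/M}\<^sub>c\<close>, so that to first order in \<open>M\<close> the factor \<open>chi(c) \<langle>c\<rangle>\<^sup>u - 1\<close> turns \<open>W(M)\<close>
  into \<open>u\<close> times the sum of the terms \<open>chi(b) \<langle>b\<rangle>\<^sup>u k / b\<close>.  The constant \<open>(c - 1) / 2\<close> can be
  added because \<open>b\<close> and \<open>M - b\<close> cancel up to \<open>O(M)\<close> when \<open>chi\<close> is even.
  All errors are \<open>u O(M)\<close>, uniformly for \<open>u\<close> near 0, which gives convergence at \<open>s = 1\<close> as well.
\<close>

subsection \<open>Ultrametric analysis\<close>

text \<open>The identity is obtained multiplied by u, and so says nothing at u = 0, that is at s =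
  1. Hence each estimate has to exhibit a factor |u| and not merely be small: division by u then
  leaves a bound that is uniform in u. This factor comes from (u choose j), which contains u for j >
  0, so the terms with j = 0 must cancel exactly wherever two series are compared. The domain of s
  is the one on which (1 + x)^u converges for |x| at most 1/q: with r = p^(-1/(p-1)) one has |j!| at
  least r^j, so for |u| at least 1 the j-th term is at most (|u| / (r q))^j. The two laws of
  exponents, in u and in 1 + x, come from rearranging double series. At s = 1 the sums are compared
  with the product of Euler factor and L-function at neighbouring points. For the trivial character
  only the limit of this product has a meaning. For other characters the Euler factor of the given c
  may still vanish at 1, so the existence of the limit of L itself cannot be read off from that
  c.\<close>

lemma nabs_0 [simp]: "nabs (0::'a::nonarch_complete_field) = 0"
  using dist_nabs[of "0::'a" 0] by simp

lemma nabs_nonneg [simp]: "nabs (x::'a::nonarch_complete_field) \<ge> 0"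
  using dist_nabs[of x 0] zero_le_dist[of x 0] by simp

lemma nabs_eq_0_iff [simp]: "nabs (x::'a::nonarch_complete_field) = 0 \<longleftrightarrow> x = 0"
  by (metis dist_nabs diff_zero dist_eq_0_iff)

lemma nabs_pos: "x \<noteq> 0 \<Longrightarrow> nabs (x::'a::nonarch_complete_field) > 0"
  using nabs_nonneg[of x] nabs_eq_0_iff[of x] by linarith

lemma nabs_1 [simp]: "nabs (1::'a::nonarch_complete_field) = 1"
  using nabs_mult[of "1::'a" 1] nabs_eq_0_iff[of "1::'a"] by simp

lemma nabs_minus [simp]: "nabs (- x) = nabs (x::'a::nonarch_complete_field)"
  using dist_nabs[of 0 x] dist_nabs[of x 0] by (simp add: dist_commute)

lemma nabs_minus_commute: "nabs (x - y) = nabs (y - x::'a::nonarch_complete_field)"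
  using nabs_minus[of "x - y"] by simp

lemma nabs_power: "nabs (x ^ n) = nabs (x::'a::nonarch_complete_field) ^ n"
  by (induction n) (auto simp: nabs_mult)

lemma nabs_divide: "nabs (x / y) = nabs x / nabs (y::'a::nonarch_complete_field)"
proof (cases "y = 0")
  case False
  have "nabs (x / y) * nabs y = nabs x"
    using False by (simp flip: nabs_mult)
  then show ?thesis
    using False by (simp add: field_simps)
qed auto

lemma nabs_inverse: "nabs (inverse x) = inverse (nabs (x::'a::nonarch_complete_field))"
  using nabs_divide[of 1 x] by (simp add: divide_inverse)

lemma nabs_prod: "nabs (\<Prod>i\<in>A. g i) = (\<Prod>i\<in>A. nabs (g i::'a::nonarch_complete_field))"
  by (induction A rule: infinite_finite_induct) (auto simp: nabs_mult)

lemma nabs_add_le: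
  "nabs x \<le> b \<Longrightarrow> nabs y \<le> b \<Longrightarrow> nabs (x + y::'a::nonarch_complete_field) \<le> b"
  using nabs_add[of x y] by linarith

lemma nabs_diff_le:
  "nabs x \<le> b \<Longrightarrow> nabs y \<le> b \<Longrightarrow> nabs (x - y::'a::nonarch_complete_field) \<le> b"
  using nabs_add_le[of x b "- y"] by simp

lemma nabs_diff_le_trans:
  "nabs (x - y) \<le> b \<Longrightarrow> nabs (y - z) \<le> b \<Longrightarrow> nabs (x - z::'a::nonarch_complete_field) \<le> b"
  using nabs_add_le[of "x - y" b "y - z"] by simp

lemma nabs_sum_le:
  assumes "\<And>i. i \<in> A \<Longrightarrow> nabs (g i) \<le> b" and "b \<ge> 0"
  shows "nabs (\<Sum>i\<in>A. g i :: 'a::nonarch_complete_field) \<le> b"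
  using assms by (induction A rule: infinite_finite_induct) (auto intro!: nabs_add_le)

lemma nabs_eq_of_close:
  assumes "nabs (x - y) < nabs (y::'a::nonarch_complete_field)"
  shows "nabs x = nabs y"
  using nabs_add[of "x - y" y] nabs_add[of "y - x" x] nabs_minus_commute[of x y] assms by simp

lemma nabs_of_nat_le_1: "nabs (of_nat n :: 'a::nonarch_complete_field) \<le> 1"
  by (induction n) (auto intro!: nabs_add_le)

lemma nabs_of_int_le_1: "nabs (of_int n :: 'a::nonarch_complete_field) \<le> 1"
  by (cases n) (simp_all add: nabs_of_nat_le_1 del: of_nat_Suc)

lemma tendsto_nabs_iff:
  "(g \<longlongrightarrow> (l::'a::nonarch_complete_field)) F \<longleftrightarrow> ((\<lambda>x. nabs (g x - l)) \<longlongrightarrow> 0) F"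
  using tendsto_dist_iff[of g l F] by (simp add: dist_nabs)

lemma tendsto_from_nabs_le:
  assumes "\<forall>\<^sub>F x in F. nabs (g x - l) \<le> h x" and "(h \<longlongrightarrow> 0) F"
  shows "(g \<longlongrightarrow> (l::'a::nonarch_complete_field)) F"
  unfolding tendsto_nabs_iff
  by (rule tendsto_sandwich[OF _ assms(1) tendsto_const assms(2)]) auto

text \<open>Gives access to the library's limit laws for sums and differences, and with them to
  calculations with \<open>summable\<close> and \<open>suminf\<close>.\<close>

instance nonarch_complete_field \<subseteq> topological_ab_group_add
proof
  fix a b :: 'a
  let ?F = "nhds a \<times>\<^sub>F nhds b"
  have "((\<lambda>x. max (nabs (fst x - a)) (nabs (snd x - b))) \<longlongrightarrow> max 0 0) ?F"
    by (intro tendsto_max)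
       (simp_all flip: tendsto_nabs_iff add: filterlim_fst filterlim_snd)
  then have lim: "((\<lambda>x. max (nabs (fst x - a)) (nabs (snd x - b))) \<longlongrightarrow> 0) ?F"
    by simp
  have "nabs (fst x + snd x - (a + b)) \<le> max (nabs (fst x - a)) (nabs (snd x - b))" for x
    using nabs_add[of "fst x - a" "snd x - b"] by (simp add: algebra_simps)
  then show "LIM x ?F. fst x + snd x :> nhds (a + b)"
    by (intro tendsto_from_nabs_le[OF always_eventually lim]) auto
next
  fix a :: 'a
  have "nabs (- x - - a) = nabs (x - a)" for x
    using nabs_minus_commute[of x a] by simp
  then show "(uminus \<longlongrightarrow> - a) (nhds a)"
    unfolding tendsto_nabs_iff[of uminus] by (simp add: filterlim_ident flip: tendsto_nabs_iff)
qed

lemma tendsto_nabs: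
  assumes "(g \<longlongrightarrow> (l::'a::nonarch_complete_field)) F"
  shows "((\<lambda>x. nabs (g x)) \<longlongrightarrow> nabs l) F"
  using tendsto_dist[OF assms tendsto_const[of 0]] by (simp add: dist_nabs)

instance nonarch_complete_field \<subseteq> topological_semigroup_mult
proof
  fix a b :: 'a
  let ?F = "nhds a \<times>\<^sub>F nhds b"
  have 1: "(fst \<longlongrightarrow> a) ?F" and 2: "(snd \<longlongrightarrow> b) ?F"
    by (simp_all add: filterlim_fst filterlim_snd)
  have "((\<lambda>x. max (nabs (fst x) * nabs (snd x - b)) (nabs (fst x - a) * nabs b)) \<longlongrightarrow>
          max (nabs a * 0) (0 * nabs b)) ?F"
    using 1 2 by (intro tendsto_max tendsto_mult tendsto_nabs) (simp_all flip: tendsto_nabs_iff)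
  then have lim: "((\<lambda>x. max (nabs (fst x) * nabs (snd x - b)) (nabs (fst x - a) * nabs b))
      \<longlongrightarrow> 0) ?F"
    by simp
  have "nabs (fst x * snd x - a * b)
      \<le> max (nabs (fst x) * nabs (snd x - b)) (nabs (fst x - a) * nabs b)" for x
    using nabs_add[of "fst x * (snd x - b)" "(fst x - a) * b"]
    by (simp add: algebra_simps flip: nabs_mult)
  then show "LIM x ?F. fst x * snd x :> nhds (a * b)"
    by (intro tendsto_from_nabs_le[OF always_eventually lim]) auto
qed

lemma nabs_limit_le:
  assumes "(g \<longlongrightarrow> (l::'a::nonarch_complete_field)) F" "F \<noteq> bot" "\<forall>\<^sub>F x in F. nabs (g x) \<le> b"
  shows "nabs l \<le> b"
  using tendsto_upperbound[OF tendsto_nabs[OF assms(1)]] assms by blast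

text \<open>By the ultrametric inequality, Cauchy sequences are those with consecutive differences tending to 0.\<close>

lemma convergent_of_differences:
  fixes X :: "nat \<Rightarrow> 'a::nonarch_complete_field"
  assumes "(\<lambda>n. X (Suc n) - X n) \<longlonglongrightarrow> 0"
  shows "convergent X"
proof (rule Cauchy_convergent, rule metric_CauchyI)
  fix e :: real
  assume e: "e > 0"
  have "(\<lambda>n. nabs (X (Suc n) - X n)) \<longlonglongrightarrow> 0"
    using tendsto_nabs[OF assms] by simp
  then have "\<forall>\<^sub>F n in sequentially. nabs (X (Suc n) - X n) < e / 2"
    using e by (intro order_tendstoD) auto
  then obtain N where N: "\<And>n. n \<ge> N \<Longrightarrow> nabs (X (Suc n) - X n) < e / 2"
    by (auto simp: eventually_sequentially)
  have close: "nabs (X n - X N) \<le> e / 2" if "n \<ge> N" for n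
    using that
  proof (induction n rule: dec_induct)
    case (step n)
    then show ?case
      using nabs_diff_le_trans[of "X (Suc n)" "X n" "e / 2" "X N"] N[of n] by simp
  qed (use e in auto)
  have "dist (X m) (X n) < e" if "m \<ge> N" "n \<ge> N" for m n
    using nabs_diff_le_trans[of "X m" "X N" "e / 2" "X n"] close[OF that(1)] close[OF that(2)] e
    by (simp add: dist_nabs nabs_minus_commute[of "X N"])
  then show "\<exists>M. \<forall>m\<ge>M. \<forall>n\<ge>M. dist (X m) (X n) < e"
    by blast
qed

lemma summable_of_tendsto_0:
  fixes g :: "nat \<Rightarrow> 'a::nonarch_complete_field"
  assumes "g \<longlonglongrightarrow> 0"
  shows "summable g"
  unfolding summable_iff_convergent
  by (rule convergent_of_differences) (use assms in simp)

text \<open>Ultrametric tail estimate: a difference of partial sums is no larger than its largest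
  term, so the bounds on the terms do not add up.\<close>

lemma nabs_suminf_diff_le:
  fixes g :: "nat \<Rightarrow> 'a::nonarch_complete_field"
  assumes "summable g" and "\<And>j. j \<ge> N \<Longrightarrow> nabs (g j) \<le> b"
  shows "nabs (suminf g - sum g {..<N}) \<le> b"
proof (rule nabs_limit_le)
  show "(\<lambda>n. sum g {..<n} - sum g {..<N}) \<longlonglongrightarrow> suminf g - sum g {..<N}"
    using assms(1) by (intro tendsto_diff summable_LIMSEQ tendsto_const)
  have "b \<ge> 0"
    using assms(2)[of N] nabs_nonneg[of "g N"] by linarith
  then have "nabs (sum g {..<n} - sum g {..<N}) \<le> b" if "n \<ge> N" for n
  proof -
    have "sum g {..<n} - sum g {..<N} = sum g {N..<n}"
      using sum_diff_nat_ivl[of 0 N n g] that by (simp add: lessThan_atLeast0)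
    then show ?thesis
      using assms(2) \<open>b \<ge> 0\<close> by (auto intro!: nabs_sum_le)
  qed
  then show "\<forall>\<^sub>F n in sequentially. nabs (sum g {..<n} - sum g {..<N}) \<le> b"
    by (auto simp: eventually_sequentially)
qed simp

lemma nabs_suminf_le:
  fixes g :: "nat \<Rightarrow> 'a::nonarch_complete_field"
  assumes "summable g" and "\<And>j. nabs (g j) \<le> b"
  shows "nabs (suminf g) \<le> b"
  using nabs_suminf_diff_le[of g 0 b] assms by simp

lemma geometric_summable:
  fixes g :: "nat \<Rightarrow> 'a::nonarch_complete_field"
  assumes "\<And>j. nabs (g j) \<le> C * \<rho> ^ j" and "0 \<le> \<rho>" and "\<rho> < 1"
  shows "summable g"
proof (rule summable_of_tendsto_0, rule tendsto_from_nabs_le)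
  show "(\<lambda>j. C * \<rho> ^ j) \<longlonglongrightarrow> 0"
    using assms by (intro tendsto_mult_right_zero LIMSEQ_power_zero) auto
qed (use assms in auto)

lemma suminf_cmult:
  fixes g :: "nat \<Rightarrow> 'a::nonarch_complete_field"
  assumes "summable g"
  shows "(\<Sum>j. c * g j) = c * suminf g"
  using tendsto_mult[OF tendsto_const[of c] summable_LIMSEQ[OF assms]]
  by (intro sums_unique[symmetric]) (simp add: sums_def sum_distrib_left)

lemma summable_cmult:
  fixes g :: "nat \<Rightarrow> 'a::nonarch_complete_field"
  assumes "summable g"
  shows "summable (\<lambda>j. c * g j)"
  using tendsto_mult[OF tendsto_const[of c] summable_LIMSEQ[OF assms]]
  by (auto simp: sums_def sum_distrib_left summable_def)

text \<open>The diagonals below N fill exactly the triangle i + j < N, and the first N rows exceed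
  it only by row tails, whose terms are at most \<open>\<rho> ^ N\<close>.\<close>

lemma suminf_double_diagonal:
  fixes T :: "nat \<Rightarrow> nat \<Rightarrow> 'a::nonarch_complete_field"
  assumes T: "\<And>i j. nabs (T i j) \<le> \<rho> ^ (i + j)" and \<rho>: "0 \<le> \<rho>" "\<rho> < 1"
  shows "(\<Sum>n. \<Sum>i\<le>n. T i (n - i)) = (\<Sum>i. \<Sum>j. T i j)"
proof (rule sums_unique[symmetric])
  have le: "\<rho> ^ (i + j) \<le> \<rho> ^ i" for i j
    using \<rho> by (intro power_decreasing) auto
  have row: "summable (T i)" for i
    by (rule geometric_summable[of _ "\<rho> ^ i" \<rho>]) (use T \<rho> in \<open>auto simp: power_add\<close>)
  have rows: "summable (\<lambda>i. \<Sum>j. T i j)"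
  proof (rule geometric_summable[of _ 1 \<rho>])
    show "nabs (\<Sum>j. T i j) \<le> 1 * \<rho> ^ i" for i
      using T le order_trans by (auto intro!: nabs_suminf_le[OF row]) blast
  qed (use \<rho> in auto)
  have tri: "(\<Sum>n<N. \<Sum>i\<le>n. T i (n - i)) = (\<Sum>i<N. \<Sum>j<N - i. T i j)" for N
  proof -
    have "(\<Sum>n<N. \<Sum>i\<le>n. T i (n - i)) = (\<Sum>(n, i)\<in>Sigma {..<N} (\<lambda>n. {..n}). T i (n - i))"
      by (simp add: sum.Sigma)
    also have "\<dots> = (\<Sum>(i, j)\<in>Sigma {..<N} (\<lambda>i. {..<N - i}). T i j)"
      by (rule sum.reindex_bij_witness[of _ "\<lambda>(i, j). (i + j, i)" "\<lambda>(n, i). (i, n - i)"]) auto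
    finally show ?thesis
      by (simp add: sum.Sigma)
  qed
  have "(\<lambda>N. (\<Sum>i<N. \<Sum>j. T i j) - (\<Sum>n<N. \<Sum>i\<le>n. T i (n - i))) \<longlonglongrightarrow> 0"
  proof (rule tendsto_from_nabs_le)
    show "(\<lambda>N. \<rho> ^ N) \<longlonglongrightarrow> 0"
      using \<rho> by (intro LIMSEQ_power_zero) auto
    have "nabs ((\<Sum>j. T i j) - (\<Sum>j<N - i. T i j)) \<le> \<rho> ^ N" if "i < N" for i N
    proof (rule nabs_suminf_diff_le[OF row])
      fix j assume "N - i \<le> j"
      then have "\<rho> ^ (i + j) \<le> \<rho> ^ N"
        using \<rho> by (intro power_decreasing) auto
      then show "nabs (T i j) \<le> \<rho> ^ N"
        using T order_trans by blast
    qed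
    then show "\<forall>\<^sub>F N in sequentially.
        nabs ((\<Sum>i<N. \<Sum>j. T i j) - (\<Sum>n<N. \<Sum>i\<le>n. T i (n - i)) - 0) \<le> \<rho> ^ N"
      unfolding tri using \<rho> by (auto simp flip: sum_subtractf intro!: always_eventually nabs_sum_le)
  qed
  from tendsto_diff[OF summable_LIMSEQ[OF rows] this]
  show "(\<lambda>n. \<Sum>i\<le>n. T i (n - i)) sums (\<Sum>i. \<Sum>j. T i j)"
    by (simp add: sums_def)
qed

subsection \<open>The binomial series\<close>

text \<open>The power (1 + x)^u with a p-adic exponent.\<close>

definition binomial_series :: "'a::nonarch_complete_field \<Rightarrow> 'a \<Rightarrow> 'a" where
  "binomial_series u x = (\<Sum>j. (u gchoose j) * x ^ j)"

lemma gbinomial_Vandermonde_atMost: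
  "(\<Sum>i\<le>n. (a gchoose i) * (b gchoose (n - i))) = (a + b :: 'a::field_char_0) gchoose n"
  using gbinomial_Vandermonde[of a b n] by (simp add: atMost_atLeast0)

lemma fact_add: "(fact (a + k) :: nat) = fact a * (\<Prod>i=1..k. a + i)"
  by (induction k) (simp_all add: algebra_simps)

locale padic =
  fixes p :: nat and K :: "'a::nonarch_complete_field itself"
  assumes prime_p: "prime p" and nabs_p: "nabs (of_nat p :: 'a) = 1 / real p"
begin

abbreviation q :: nat where "q \<equiv> qq p"

text \<open>The radius of convergence of the p-adic exponential series: |n!| decays no faster than
  the n-th power of this number.\<close>

definition fact_radius :: real where "fact_radius = real p powr (- 1 / (real p - 1))"

lemma p_ge_2: "p \<ge> 2"
  using prime_p by (rule prime_ge_2_nat)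

lemma p_dvd_q: "p dvd q"
  by (simp add: qq_def)

lemma q_gt_1: "q > 1"
  using p_ge_2 by (simp add: qq_def)

lemma q_power: obtains e where "q = p ^ e" "e > 0"
  by (cases "p = 2") (auto simp: qq_def intro: that[of 2] that[of 1])

lemma nabs_q: "nabs (of_nat q :: 'a) = 1 / real q"
proof -
  obtain e where "q = p ^ e"
    by (rule q_power)
  then show ?thesis
    by (simp add: nabs_power nabs_p power_one_over)
qed

lemma fact_radius_pos: "fact_radius > 0"
  using p_ge_2 by (simp add: fact_radius_def)

lemma fact_radius_power: "fact_radius ^ (p - 1) = 1 / real p"
proof -
  have "fact_radius ^ (p - 1) = real p powr (- 1)"
    using p_ge_2 by (simp add: fact_radius_def powr_power of_nat_diff)
  then show ?thesis
    using p_ge_2 by (simp add: powr_minus_divide)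
qed

lemma fact_radius_less_1: "fact_radius < 1"
  using p_ge_2 by (auto simp: fact_radius_def intro!: powr_less_one)

text \<open>The disc of exponents therefore contains the closed unit ball, in particular all
  integers. For p = 2 the radius is 1/2, and q = 4 is what makes the product exceed 1; for odd p the
  exponent 1 - 1/(p - 1) is positive.\<close>

lemma qr_gt_1: "real q * fact_radius > 1"
proof (cases "p = 2")
  case True
  have "fact_radius = 1 / 2"
    using fact_radius_power True by simp
  then show ?thesis
    by (simp add: qq_def True)
next
  case False
  then have "p \<ge> 3"
    using p_ge_2 by simp
  then have "real p powr (1 + - 1 / (real p - 1)) > 1"
    by (intro gr_one_powr) (auto simp: field_simps)
  then have "real p * fact_radius > 1"
    unfolding powr_add fact_radius_def using \<open>p \<ge> 3\<close> by simp
  then show ?thesis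
    using False by (simp add: qq_def)
qed

section \<open>p-adic sizes of integers, factorials and binomial coefficients\<close>

lemma not_dvd_of_coprime:
  assumes "coprime c (int p)"
  shows "\<not> int p dvd c"
  using assms prime_p by (metis coprime_absorb_right coprime_commute not_prime_unit prime_nat_int_transfer)

text \<open>In a Bezout relation p u + a v = 1 the first summand has size below 1, so |a v|, and
  with it |a|, cannot be below 1.\<close>

lemma nabs_of_int_coprime:
  assumes "\<not> int p dvd a"
  shows "nabs (of_int a :: 'a) = 1"
proof -
  have "coprime (int p) a"
    using assms prime_p by (simp add: prime_imp_coprime)
  then obtain u v where "int p * u + a * v = 1"
    using bezout_int[of "int p" a] by (metis coprime_imp_gcd_eq_1 mult.commute)
  then have "1 = (of_int (int p * u + a * v) :: 'a)"
    by simp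
  then have "1 = (of_nat p * of_int u + of_int a * of_int v :: 'a)"
    by simp
  then have "1 \<le> max (nabs (of_nat p * of_int u :: 'a)) (nabs (of_int a * of_int v :: 'a))"
    using nabs_add nabs_1 by metis
  moreover have "nabs (of_nat p * of_int u :: 'a) < 1"
  proof -
    have "nabs (of_nat p * of_int u :: 'a) \<le> 1 / real p * 1"
      unfolding nabs_mult nabs_p by (intro mult_left_mono nabs_of_int_le_1) auto
    then show ?thesis
      using p_ge_2 by (simp add: order_le_less_trans)
  qed
  moreover have "nabs (of_int a * of_int v :: 'a) \<le> nabs (of_int a :: 'a) * 1"
    unfolding nabs_mult by (intro mult_left_mono nabs_of_int_le_1) auto
  ultimately show ?thesis
    using nabs_of_int_le_1[of a, where 'a = 'a] by linarith
qed

lemma nabs_of_nat_coprime: "\<not> p dvd n \<Longrightarrow> nabs (of_nat n :: 'a) = 1"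
  using nabs_of_int_coprime[of "int n"] by simp

text \<open>Stripping factors p one at a time: the power of p contained in n is at most n.\<close>

lemma nabs_of_nat_ge: "n > 0 \<Longrightarrow> nabs (of_nat n :: 'a) \<ge> 1 / real n"
proof (induction n rule: less_induct)
  case (less n)
  show ?case
  proof (cases "p dvd n")
    case True
    then obtain m where m: "n = p * m"
      by blast
    then have "nabs (of_nat m :: 'a) \<ge> 1 / real m"
      using less p_ge_2 by auto
    then have "(1 / real p) * (1 / real m) \<le> (1 / real p) * nabs (of_nat m :: 'a)"
      by (intro mult_left_mono) auto
    then show ?thesis
      by (simp add: m nabs_mult nabs_p)
  qed (use less nabs_of_nat_coprime in auto)
qed

lemma nabs_of_nat_multiple:
  assumes "m dvd n"
  shows "nabs (of_nat n :: 'a) \<le> nabs (of_nat m :: 'a)"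
proof -
  obtain k where "n = m * k"
    using assms by blast
  then show ?thesis
    using nabs_of_nat_le_1[of k, where 'a = 'a] by (simp add: nabs_mult mult_left_le)
qed

text \<open>Among the factors p m + 1, ..., p m + p only the last is divisible by p, and it equals p
  (m + 1).\<close>

lemma nabs_fact_mult: "nabs (fact (p * m) :: 'a) = (1 / real p) ^ m * nabs (fact m :: 'a)"
proof (induction m)
  case (Suc m)
  have "(fact (p * Suc m) :: nat) = fact (p * m) * (\<Prod>i=1..p. p * m + i)"
    using fact_add[of "p * m" p] by (simp add: add.commute)
  also have "(\<Prod>i=1..p. p * m + i) = (\<Prod>i\<in>{1..<p}. p * m + i) * (p * Suc m)"
  proof -
    have "{1..p} = insert p {1..<p}"
      using p_ge_2 by auto
    then show ?thesis
      by (simp add: mult.commute)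
  qed
  finally have "(of_nat (fact (p * Suc m)) :: 'a) =
      of_nat (fact (p * m) * ((\<Prod>i\<in>{1..<p}. p * m + i) * (p * Suc m)))"
    by (simp only:)
  moreover have "nabs (of_nat (\<Prod>i\<in>{1..<p}. p * m + i) :: 'a) = 1"
  proof -
    have "\<not> p dvd (p * m + i)" if "i \<in> {1..<p}" for i
      using that by (auto simp: dvd_add_right_iff dest: dvd_imp_le)
    then have "nabs (of_nat (p * m + i) :: 'a) = 1" if "i \<in> {1..<p}" for i
      using that nabs_of_nat_coprime by blast
    then show ?thesis
      unfolding of_nat_prod nabs_prod by (intro prod.neutral) blast
  qed
  ultimately have "nabs (fact (p * Suc m) :: 'a) =
      nabs (fact (p * m) :: 'a) * (nabs (of_nat p :: 'a) * nabs (of_nat (Suc m) :: 'a))"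
    by (simp add: nabs_mult del: of_nat_Suc mult_Suc_right)
  then show ?case
    by (simp add: Suc.IH nabs_p nabs_mult)
qed simp

text \<open>Legendre's bound v(n!) \<le> n / (p - 1) in recursive form: with m = n div p one has
  |n!| = p^(-m) |m!|, and writing p m = (p - 1) m + m turns \<open>fact_radius ^ (p * m)\<close>
  into p^(-m) times \<open>fact_radius ^ m\<close>.\<close>

lemma nabs_fact_ge: "nabs (fact n :: 'a) \<ge> fact_radius ^ n"
proof (induction n rule: less_induct)
  case (less n)
  define m where "m = n div p"
  have mono: "nabs (fact (p * m) :: 'a) = nabs (fact n :: 'a)"
  proof -
    have "nabs (fact (p * m + i) :: 'a) = nabs (fact (p * m) :: 'a)" if "i < p" for i
      using that
    proof (induction i)
      case (Suc i)
      have "\<not> p dvd (p * m + Suc i)"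
        using Suc.prems by (auto simp: dvd_add_right_iff dest: dvd_imp_le simp del: add_Suc_right)
      then have "nabs (of_nat (p * m + Suc i) :: 'a) = 1"
        by (rule nabs_of_nat_coprime)
      moreover have "(fact (p * m + Suc i) :: 'a) = of_nat (p * m + Suc i) * fact (p * m + i)"
        by simp
      ultimately show ?case
        using Suc by (simp add: nabs_mult del: fact_Suc)
    qed simp
    from this[of "n mod p"] show ?thesis
      using p_ge_2 by (simp add: m_def)
  qed
  show ?case
  proof (cases "n = 0")
    case False
    then have "m < n"
      using p_ge_2 by (simp add: m_def)
    have "p * m \<le> n"
      by (simp add: m_def)
    then have "fact_radius ^ n \<le> fact_radius ^ (p * m)"
      using fact_radius_pos fact_radius_less_1 by (intro power_decreasing) auto
    also have "p * m = (p - 1) * m + m"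
      using p_ge_2 by (simp add: algebra_simps diff_mult_distrib)
    also have "fact_radius ^ \<dots> = (1 / real p) ^ m * fact_radius ^ m"
      by (simp only: power_add power_mult fact_radius_power)
    also have "\<dots> \<le> (1 / real p) ^ m * nabs (fact m :: 'a)"
      using less[OF \<open>m < n\<close>] by (intro mult_left_mono) auto
    finally show ?thesis
      using nabs_fact_mult mono by simp
  qed simp
qed

text \<open>Each of the j factors u - i of the numerator has size at most R, because R \<ge> 1 also
  bounds i. The second form keeps the factor with i = 0, which is u itself; it is the source of the
  factor |u| in all later error bounds.\<close>

lemma nabs_gbinomial_le:
  assumes "nabs (u::'a) \<le> R" and "R \<ge> 1"
  shows "nabs (u gchoose j) \<le> (R / fact_radius) ^ j"
    and "j > 0 \<Longrightarrow> nabs (u gchoose j) \<le> nabs u * (R / fact_radius) ^ j"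
proof -
  have factor: "nabs (u - of_nat i) \<le> R" for i
    using assms nabs_of_nat_le_1[of i, where 'a = 'a] by (intro nabs_diff_le) auto
  have prod_le: "(\<Prod>i\<in>A. nabs (u - of_nat i)) \<le> R ^ card A" for A :: "nat set"
    using prod_mono[of A "\<lambda>i. nabs (u - of_nat i)" "\<lambda>_. R"] factor by simp
  have eq: "nabs (u gchoose j) = (\<Prod>i\<in>{0..<j}. nabs (u - of_nat i)) / nabs (fact j :: 'a)"
    by (simp add: gbinomial_prod_rev nabs_divide nabs_prod)
  have fact_le: "(\<Prod>i\<in>{0..<j}. nabs (u - of_nat i)) / nabs (fact j :: 'a)
      \<le> (\<Prod>i\<in>{0..<j}. nabs (u - of_nat i)) / fact_radius ^ j"
    using nabs_fact_ge[of j] fact_radius_pos by (intro divide_left_mono) (auto intro!: prod_nonneg mult_pos_pos nabs_pos)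
  show "nabs (u gchoose j) \<le> (R / fact_radius) ^ j"
    using fact_le prod_le[of "{0..<j}"] fact_radius_pos
    by (simp add: eq power_divide divide_right_mono order_trans[OF fact_le])
  assume "j > 0"
  then have split: "{0..<j} = insert 0 {1..<j}"
    by auto
  have "(\<Prod>i\<in>{0..<j}. nabs (u - of_nat i)) = nabs u * (\<Prod>i\<in>{1..<j}. nabs (u - of_nat i))"
    unfolding split by simp
  also have "\<dots> \<le> nabs u * R ^ (j - 1)"
    using prod_le[of "{1..<j}"] by (intro mult_left_mono) auto
  also have "\<dots> \<le> nabs u * R ^ j"
    using assms by (intro mult_left_mono power_increasing) auto
  finally show "nabs (u gchoose j) \<le> nabs u * (R / fact_radius) ^ j"
    unfolding eq power_divide times_divide_eq_right using fact_radius_pos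
    by (intro order_trans[OF fact_le] divide_right_mono) auto
qed

text \<open>The ratio of the geometric series that dominates (1 + x)^u for |u| \<le> R and |x| \<le>
  1/q; it is below 1 exactly on the radii allowed for exponents.\<close>

definition rho :: "real \<Rightarrow> real" where "rho R = R / (fact_radius * real q)"

lemma rho_bounds:
  assumes "1 \<le> R" and "R < real q * fact_radius"
  shows "0 < rho R" and "rho R < 1"
  using assms fact_radius_pos q_gt_1 by (auto simp: rho_def field_simps)

text \<open>The scale \<open>t\<close> is kept apart from \<open>rho R\<close>: t = 1 gives
  convergence, while t = |x| q measures the gain when x is smaller than 1/q.\<close>

lemma nabs_binomial_term_le:
  assumes "nabs (u::'a) \<le> R" and "1 \<le> R" and "nabs x \<le> t / real q"
  shows "nabs ((u gchoose j) * x ^ j) \<le> t ^ j * rho R ^ j"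
    and "j > 0 \<Longrightarrow> nabs ((u gchoose j) * x ^ j) \<le> nabs u * (t ^ j * rho R ^ j)"
proof -
  have x: "nabs x ^ j \<le> (t / real q) ^ j"
    using assms by (intro power_mono) auto
  have *: "t ^ j * rho R ^ j = (R / fact_radius) ^ j * (t / real q) ^ j"
    using fact_radius_pos by (simp add: rho_def field_simps)
  show "nabs ((u gchoose j) * x ^ j) \<le> t ^ j * rho R ^ j"
    unfolding * nabs_mult nabs_power using x assms fact_radius_pos
    by (intro mult_mono nabs_gbinomial_le) auto
  assume "j > 0"
  have "nabs (u gchoose j) * nabs x ^ j \<le> nabs u * (R / fact_radius) ^ j * (t / real q) ^ j"
    using x assms fact_radius_pos \<open>j > 0\<close> by (intro mult_mono nabs_gbinomial_le) auto
  then show "nabs ((u gchoose j) * x ^ j) \<le> nabs u * (t ^ j * rho R ^ j)"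
    unfolding * by (simp only: nabs_mult nabs_power mult.assoc)
qed

section \<open>Convergence and laws of the binomial series on the disc of exponents\<close>

definition disc :: "'a set" where "disc = {u. nabs u < real q * fact_radius}"

text \<open>The radius is \<open>max 1 (nabs u)\<close>, since the factors u - i of a binomial
  coefficient can have size 1 even when u is small.\<close>

lemma disc_radius:
  assumes "u \<in> disc"
  obtains R where "nabs u \<le> R" "1 \<le> R" "R < real q * fact_radius"
  using assms qr_gt_1 by (intro that[of "max 1 (nabs u)"]) (auto simp: disc_def)

lemma disc_radius2:
  assumes "u \<in> disc" "v \<in> disc"
  obtains R where "nabs u \<le> R" "nabs v \<le> R" "1 \<le> R" "R < real q * fact_radius"
  using assms qr_gt_1
  by (intro that[of "max 1 (max (nabs u) (nabs v))"]) (auto simp: disc_def)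

lemma disc_add: "u \<in> disc \<Longrightarrow> v \<in> disc \<Longrightarrow> u + v \<in> disc"
  using nabs_add[of u v] by (auto simp: disc_def)

lemma disc_minus: "u \<in> disc \<Longrightarrow> - u \<in> disc"
  by (simp add: disc_def)

lemma disc_of_nat: "of_nat n \<in> disc"
  using nabs_of_nat_le_1[of n, where 'a = 'a] qr_gt_1 by (simp add: disc_def)

lemma disc_1: "1 \<in> disc"
  using disc_of_nat[of 1] by simp

lemma disc_diff: "u \<in> disc \<Longrightarrow> v \<in> disc \<Longrightarrow> u - v \<in> disc"
  using disc_add[OF _ disc_minus, of u v] by simp

lemma binomial_series_summable:
  assumes "u \<in> disc" and "nabs x \<le> 1 / real q"
  shows "summable (\<lambda>j. (u gchoose j) * x ^ j)"
proof -
  obtain R where R: "nabs u \<le> R" "1 \<le> R" "R < real q * fact_radius"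
    using assms(1) by (rule disc_radius)
  show ?thesis
    by (rule geometric_summable[of _ 1 "rho R"])
       (use nabs_binomial_term_le(1)[OF R(1,2), of x 1] rho_bounds[OF R(2,3)] assms in auto)
qed

lemma nabs_binomial_term_le_1:
  assumes "u \<in> disc" and "nabs x \<le> 1 / real q"
  shows "nabs ((u gchoose j) * x ^ j) \<le> 1"
proof -
  obtain R where R: "nabs u \<le> R" "1 \<le> R" "R < real q * fact_radius"
    using assms(1) by (rule disc_radius)
  have "rho R ^ j \<le> 1"
    using rho_bounds[OF R(2,3)] by (intro power_le_one) auto
  then show ?thesis
    using nabs_binomial_term_le(1)[OF R(1,2), of x 1 j] assms by simp
qed

lemma nabs_binomial_series_le_1:
  assumes "u \<in> disc" and "nabs x \<le> 1 / real q"
  shows "nabs (binomial_series u x) \<le> 1"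
  unfolding binomial_series_def
  using assms by (intro nabs_suminf_le binomial_series_summable nabs_binomial_term_le_1)

text \<open>The first omitted power of x governs the error. Bounding the powers of
  \<open>rho R\<close> by 1 makes the bound depend on u only through |u|. With n > 0 the constant
  term 1, which has no factor u, is among the terms removed.\<close>

lemma nabs_binomial_series_tail_le:
  assumes "u \<in> disc" and "nabs x \<le> 1 / real q" and "n > 0"
  shows "nabs (binomial_series u x - (\<Sum>j<n. (u gchoose j) * x ^ j))
    \<le> nabs u * (nabs x * real q) ^ n"
  unfolding binomial_series_def
proof (rule nabs_suminf_diff_le[OF binomial_series_summable[OF assms(1,2)]])
  fix j assume j: "j \<ge> n"
  obtain R where R: "nabs u \<le> R" "1 \<le> R" "R < real q * fact_radius"
    using assms(1) by (rule disc_radius)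
  have "nabs ((u gchoose j) * x ^ j) \<le> nabs u * ((nabs x * real q) ^ j * rho R ^ j)"
    using assms(3) j q_gt_1 by (intro nabs_binomial_term_le R) auto
  also have "\<dots> \<le> nabs u * ((nabs x * real q) ^ n * 1)"
    using rho_bounds[OF R(2,3)] assms(2) j q_gt_1
    by (intro mult_left_mono mult_mono power_decreasing power_le_one) (auto simp: field_simps)
  finally show "nabs ((u gchoose j) * x ^ j) \<le> nabs u * (nabs x * real q) ^ n"
    by simp
qed

lemma nabs_binomial_series_minus_1:
  assumes "u \<in> disc" and "nabs x \<le> 1 / real q"
  shows "nabs (binomial_series u x - 1) \<le> nabs u * (nabs x * real q)"
  using nabs_binomial_series_tail_le[OF assms, of 1] by simp

text \<open>Cauchy product of the two series; the coefficients on a diagonal add up by Vandermonde's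
  identity.\<close>

lemma binomial_series_add:
  assumes "u \<in> disc" "v \<in> disc" and x: "nabs x \<le> 1 / real q"
  shows "binomial_series (u + v) x = binomial_series u x * binomial_series v x"
proof -
  define T where "T i j = ((u gchoose i) * x ^ i) * ((v gchoose j) * x ^ j)" for i j
  obtain R where R: "nabs u \<le> R" "nabs v \<le> R" "1 \<le> R" "R < real q * fact_radius"
    using assms(1,2) by (rule disc_radius2)
  have \<rho>: "0 \<le> rho R" "rho R < 1"
    using rho_bounds[OF R(3,4)] by auto
  have "nabs (T i j) \<le> rho R ^ (i + j)" for i j
    unfolding T_def nabs_mult[of "_ * _" "_ * _"] power_add
    using nabs_binomial_term_le(1)[OF R(1,3), of x 1 i] nabs_binomial_term_le(1)[OF R(2,3), of x 1 j] x \<rho>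
    by (intro mult_mono) auto
  from suminf_double_diagonal[OF this \<rho>]
  have "(\<Sum>n. \<Sum>i\<le>n. T i (n - i)) = (\<Sum>i. \<Sum>j. T i j)" .
  also have "(\<Sum>n. \<Sum>i\<le>n. T i (n - i)) = binomial_series (u + v) x"
  proof -
    have "(\<Sum>i\<le>n. T i (n - i)) = (u + v gchoose n) * x ^ n" for n
    proof -
      have "T i (n - i) = (u gchoose i) * (v gchoose (n - i)) * x ^ n" if "i \<le> n" for i
        using that power_add[of x i "n - i"] by (simp add: T_def)
      then show ?thesis
        by (simp add: gbinomial_Vandermonde_atMost flip: sum_distrib_right)
    qed
    then show ?thesis
      by (simp add: binomial_series_def)
  qed
  also have "(\<Sum>i. \<Sum>j. T i j) = (\<Sum>i. binomial_series v x * ((u gchoose i) * x ^ i))"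
    unfolding T_def suminf_cmult[OF binomial_series_summable[OF assms(2) x]]
    by (simp add: binomial_series_def mult.commute)
  also have "\<dots> = binomial_series u x * binomial_series v x"
    unfolding suminf_cmult[OF binomial_series_summable[OF assms(1) x]]
    by (simp add: binomial_series_def mult.commute)
  finally show ?thesis .
qed

lemma binomial_series_of_nat: "binomial_series (of_nat n) x = (1 + x) ^ n"
proof -
  have "(\<lambda>j. (of_nat n gchoose j) * x ^ j) sums (\<Sum>j\<le>n. (of_nat n gchoose j) * x ^ j)"
    by (rule sums_finite) (auto simp: binomial_gbinomial[symmetric])
  then have "binomial_series (of_nat n) x = (\<Sum>j\<le>n. of_nat (n choose j) * x ^ j)"
    unfolding binomial_series_def binomial_gbinomial by (rule sums_unique[symmetric])
  then show ?thesis
    using binomial_ring[of x 1 n] by (simp add: add.commute)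
qed

text \<open>
  Expanding \<open>(x + y (1 + x))\<close> binomially and collecting powers of \<open>y\<close>, the coefficient of
  \<open>y\<^sup>i\<close> is \<open>(u gchoose i) (1 + x)\<^sup>i\<close> times the series of exponent \<open>u - i\<close>
  at \<open>x\<close>, and the first two factors combine by additivity in the exponent.
\<close>

lemma binomial_series_mult:
  assumes u: "u \<in> disc" and x: "nabs x \<le> 1 / real q" and y: "nabs y \<le> 1 / real q"
  shows "binomial_series u (x + y + x * y) = binomial_series u x * binomial_series u y"
proof -
  define z where "z = y * (1 + x)"
  have q1: "1 / real q \<le> 1"
    using q_gt_1 by simp
  have z: "nabs z \<le> 1 / real q"
  proof -
    have "nabs (1 + x) \<le> 1"
      using x q1 by (intro nabs_add_le) auto
    then show ?thesis
      using y mult_left_le[of "nabs (1 + x)" "nabs y"] by (simp add: z_def nabs_mult)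
  qed
  define T where "T i j = (u gchoose (i + j)) * (of_nat ((i + j) choose i) * (z ^ i * x ^ j))" for i j
  obtain R where R: "nabs u \<le> R" "1 \<le> R" "R < real q * fact_radius"
    using u by (rule disc_radius)
  have \<rho>: "0 \<le> rho R" "rho R < 1"
    using rho_bounds[OF R(2,3)] by auto
  have "nabs (T i j) \<le> rho R ^ (i + j)" for i j
  proof -
    have "nabs (of_nat ((i + j) choose i) * (z ^ i * x ^ j)) \<le> 1 * ((1 / real q) ^ i * (1 / real q) ^ j)"
      unfolding nabs_mult nabs_power
      using x z by (intro mult_mono power_mono nabs_of_nat_le_1) auto
    then have "nabs (T i j) \<le> (R / fact_radius) ^ (i + j) * (1 * ((1 / real q) ^ i * (1 / real q) ^ j))"
      unfolding T_def nabs_mult[of "u gchoose _"] using R fact_radius_pos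
      by (intro mult_mono nabs_gbinomial_le) auto
    also have "\<dots> = (R / fact_radius * (1 / real q)) ^ (i + j)"
      by (simp only: mult_1_left power_mult_distrib flip: power_add)
    finally show ?thesis
      by (simp add: rho_def)
  qed
  from suminf_double_diagonal[OF this \<rho>]
  have "(\<Sum>n. \<Sum>i\<le>n. T i (n - i)) = (\<Sum>i. \<Sum>j. T i j)" .
  also have "(\<Sum>n. \<Sum>i\<le>n. T i (n - i)) = binomial_series u (z + x)"
  proof -
    have "(\<Sum>i\<le>n. T i (n - i)) = (u gchoose n) * (z + x) ^ n" for n
    proof -
      have "T i (n - i) = (u gchoose n) * (of_nat (n choose i) * z ^ i * x ^ (n - i))" if "i \<le> n" for i
        using that by (simp add: T_def)
      then show ?thesis
        by (simp add: binomial_ring flip: sum_distrib_left)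
    qed
    then show ?thesis
      by (simp add: binomial_series_def)
  qed
  also have "(\<Sum>i. \<Sum>j. T i j) = (\<Sum>i. binomial_series u x * ((u gchoose i) * y ^ i))"
  proof (rule suminf_cong)
    fix i
    have mem: "u - of_nat i \<in> disc"
      using u disc_of_nat by (rule disc_diff)
    have "T i j = ((u gchoose i) * z ^ i) * ((u - of_nat i gchoose j) * x ^ j)" for j
      using gbinomial_trinomial_revision[of i "i + j" u]
      by (simp add: T_def binomial_gbinomial algebra_simps)
    then have "(\<Sum>j. T i j) = ((u gchoose i) * z ^ i) * binomial_series (u - of_nat i) x"
      by (simp add: suminf_cmult[OF binomial_series_summable[OF mem x]] binomial_series_def)
    also have "\<dots> = ((u gchoose i) * y ^ i) * (binomial_series (of_nat i) x * binomial_series (u - of_nat i) x)"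
      by (simp add: z_def power_mult_distrib binomial_series_of_nat)
    also have "\<dots> = ((u gchoose i) * y ^ i) * binomial_series u x"
      using binomial_series_add[OF disc_of_nat mem x, of i] by simp
    finally show "(\<Sum>j. T i j) = binomial_series u x * ((u gchoose i) * y ^ i)"
      by simp
  qed
  also have "\<dots> = binomial_series u x * binomial_series u y"
    unfolding suminf_cmult[OF binomial_series_summable[OF u y]]
    by (simp add: binomial_series_def)
  finally show ?thesis
    by (simp add: z_def algebra_simps)
qed

end

subsection \<open>The Teichmueller character\<close>

instance nonarch_complete_field \<subseteq> topological_comm_monoid_mult ..

lemma nabs_le_1_of_padic_ints:
  assumes "y \<in> (padic_ints :: 'a::nonarch_complete_field set)"
  shows "nabs y \<le> 1"
proof -
  obtain g where g: "\<And>n. g n \<in> (\<int> :: 'a set)" "g \<longlonglongrightarrow> y"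
    using assms by (auto simp: padic_ints_def closure_sequential)
  have "nabs (g n) \<le> 1" for n
    using g(1)[of n] by (auto elim!: Ints_cases simp: nabs_of_int_le_1)
  then show ?thesis
    by (intro nabs_limit_le[OF g(2)]) auto
qed

lemma euler_theorem_int:
  assumes "coprime a (int m)" "m > 0"
  shows "[a ^ totient m = 1] (mod int m)"
proof (cases "m = 1")
  case False
  then interpret residues "int m" "residue_ring (int m)"
    using assms(2) by unfold_locales auto
  show ?thesis
    using euler_theorem[OF assms(1)] by simp
qed auto

lemma nabs_power_diff_le:
  fixes z w :: "'a::nonarch_complete_field"
  assumes "nabs z \<le> 1" "nabs w \<le> 1"
  shows "nabs (z ^ i - w ^ i) \<le> nabs (z - w)"
proof -
  have "nabs (\<Sum>j<i. w ^ (i - Suc j) * z ^ j) \<le> 1"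
    using assms by (intro nabs_sum_le) (auto simp: nabs_mult nabs_power intro!: mult_le_one power_le_one)
  then show ?thesis
    unfolding power_diff_sumr2 nabs_mult by (simp add: mult_left_le)
qed

context padic
begin

abbreviation T :: "int \<Rightarrow> 'a" where "T \<equiv> teichmuller p"

definition teich_order :: nat where "teich_order = (if p = 2 then 2 else p - 1)"

lemma teich_order_pos: "teich_order > 0"
  using p_ge_2 by (simp add: teich_order_def)

text \<open>Taking p-th powers sharpens a congruence by one more factor p: when z and w agree modulo
  p, the cofactor of z - w in z^p - w^p is congruent to p w^(p-1), hence to 0, modulo p.\<close>

lemma nabs_power_p_diff_le:
  fixes z w :: 'a
  assumes "nabs z \<le> 1" "nabs w \<le> 1" "nabs (z - w) \<le> 1 / real p"
  shows "nabs (z ^ p - w ^ p) \<le> nabs (z - w) * (1 / real p)"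
proof -
  have *: "nabs (w ^ (p - Suc i) * z ^ i - w ^ (p - 1)) \<le> 1 / real p" if "i < p" for i
  proof -
    have "w ^ (p - Suc i) * z ^ i - w ^ (p - 1) = w ^ (p - Suc i) * (z ^ i - w ^ i)"
      using that by (simp add: algebra_simps flip: power_add)
    also have "nabs \<dots> \<le> 1 * nabs (z - w)"
      unfolding nabs_mult nabs_power[of w] using assms
      by (intro mult_mono nabs_power_diff_le power_le_one) auto
    finally show ?thesis
      using assms by simp
  qed
  have "nabs ((\<Sum>i<p. w ^ (p - Suc i) * z ^ i - w ^ (p - 1)) + of_nat p * w ^ (p - 1)) \<le> 1 / real p"
  proof (rule nabs_add_le)
    show "nabs (of_nat p * w ^ (p - 1)) \<le> 1 / real p"
      unfolding nabs_mult nabs_p nabs_power using assms p_ge_2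
      by (simp add: divide_right_mono power_le_one)
  qed (use * in \<open>auto intro!: nabs_sum_le\<close>)
  then have "nabs (\<Sum>i<p. w ^ (p - Suc i) * z ^ i) \<le> 1 / real p"
    by (simp add: sum_subtractf)
  then show ?thesis
    unfolding power_diff_sumr2 nabs_mult by (intro mult_left_mono) auto
qed

lemma nabs_root_of_unity:
  assumes "(z::'a) ^ n = 1" and "n > 0"
  shows "nabs z = 1"
proof -
  have "nabs z ^ n = 1 ^ n"
    using assms(1) by (simp flip: nabs_power)
  then show ?thesis
    using assms(2) by (intro power_eq_imp_eq_base[of _ n 1]) auto
qed

text \<open>For odd p both numbers equal their p-th powers, so the contraction gives |z - w| \<le>
  |z - w| / p. For p = 2 the candidates 1 and -1 are at distance 1/2, which closeness modulo 4
  excludes.\<close>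

lemma root_of_unity_unique:
  fixes z w :: 'a
  assumes "z ^ teich_order = 1" "w ^ teich_order = 1" "nabs (z - w) \<le> 1 / real q"
  shows "z = w"
proof (cases "p = 2")
  case True
  have "teich_order = 2"
    unfolding teich_order_def using True by simp
  then have "z = 1 \<or> z = -1" "w = 1 \<or> w = -1"
    using assms by (auto simp: power2_eq_1_iff)
  moreover have "nabs (2 :: 'a) = 1 / 2"
    using nabs_p True by simp
  ultimately show ?thesis
    using assms(3) True nabs_minus[of "2::'a"] by (auto simp: qq_def)
next
  case False
  then have "z ^ p = z" "w ^ p = w"
    using assms power_Suc[of z teich_order] power_Suc[of w teich_order] p_ge_2 by (simp_all add: teich_order_def)
  moreover have "nabs z = 1" "nabs w = 1"
    using assms teich_order_pos by (auto intro: nabs_root_of_unity)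
  ultimately have "nabs (z - w) \<le> nabs (z - w) * (1 / real p)"
    using nabs_power_p_diff_le[of z w] assms(3) False by (simp add: qq_def)
  then have "nabs (z - w) * (1 - 1 / real p) \<le> 0"
    by (simp add: algebra_simps)
  moreover have "1 - 1 / real p > 0"
    using p_ge_2 by simp
  ultimately have "nabs (z - w) \<le> 0"
    by (simp add: mult_le_0_iff)
  then have "nabs (z - w) = 0"
    using nabs_nonneg[of "z - w"] by linarith
  then show ?thesis
    by simp
qed

lemma fermat_int: "int p dvd a ^ p - a"
proof (cases "int p dvd a")
  case False
  then have "coprime (int p) a"
    using prime_p by (simp add: prime_imp_coprime)
  then have "coprime a (int p)"
    by (simp add: coprime_commute)
  then have "[a ^ (p - 1) = 1] (mod int p)"
    using euler_theorem_int[of a p] prime_p p_ge_2 by (simp add: totient_prime)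
  then have "[a * a ^ (p - 1) = a * 1] (mod int p)"
    by (rule cong_scalar_left)
  then show ?thesis
    using p_ge_2 by (simp add: cong_iff_dvd_diff flip: power_Suc)
next
  case True
  then show ?thesis
    using p_ge_2 by (intro dvd_diff dvd_trans[OF True dvd_power]) auto
qed

lemma nabs_of_int_dvd:
  assumes "int n dvd a"
  shows "nabs (of_int a :: 'a) \<le> nabs (of_nat n :: 'a)"
proof -
  obtain k where "a = int n * k"
    using assms by blast
  then show ?thesis
    using nabs_of_int_le_1[of k, where 'a = 'a] by (simp add: nabs_mult mult_left_le)
qed

text \<open>The root of unity is the limit of the powers of \<open>a\<close> with exponents \<open>p\<^sup>n\<close>.\<close>

lemma root_of_unity_congruent_mod_p:
  assumes a: "\<not> int p dvd a"
  shows "\<exists>z::'a. z \<in> padic_ints \<and> z ^ (p - 1) = 1 \<and> (\<exists>y\<in>padic_ints. z - of_int a = of_nat p * y)"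
proof -
  define X where "X n = (of_int (a ^ (p ^ n)) :: 'a)" for n
  have le_1: "nabs (X n) \<le> 1" for n
    by (simp add: X_def nabs_of_int_le_1 del: of_int_power)
  have X_Suc: "X (Suc n) = X n ^ p" for n
    by (simp add: X_def mult.commute flip: power_mult)
  \<comment> \<open>Fermat's congruence starts the induction; each further p-th power gains a factor
    p by \<open>nabs_power_p_diff_le\<close>.\<close>
  have diff: "nabs (X (Suc n) - X n) \<le> (1 / real p) ^ Suc n" for n
  proof (induction n)
    case 0
    show ?case
      using nabs_of_int_dvd[OF fermat_int[of a]] by (simp add: X_def nabs_p)
  next
    case (Suc n)
    have "(1 / real p) ^ Suc n \<le> (1 / real p) ^ 1"
      using p_ge_2 by (intro power_decreasing) auto
    then have "nabs (X (Suc n) - X n) \<le> 1 / real p"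
      using Suc unfolding power_one_right by linarith
    then have "nabs (X (Suc n) ^ p - X n ^ p) \<le> nabs (X (Suc n) - X n) * (1 / real p)"
      by (intro nabs_power_p_diff_le le_1)
    also have "\<dots> \<le> (1 / real p) ^ Suc n * (1 / real p)"
      using Suc by (intro mult_right_mono) auto
    finally show ?case
      by (simp only: X_Suc mult.commute power_Suc)
  qed
  have "(\<lambda>n. (1 / real p) ^ Suc n) \<longlonglongrightarrow> 0"
    using p_ge_2 by (intro LIMSEQ_Suc LIMSEQ_power_zero) auto
  then have "(\<lambda>n. X (Suc n) - X n) \<longlonglongrightarrow> 0"
    using diff by (intro tendsto_from_nabs_le[of _ _ "\<lambda>n. (1 / real p) ^ Suc n"]) auto
  then obtain l where l: "X \<longlonglongrightarrow> l"
    using convergent_of_differences unfolding convergent_def by blast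
  have "l ^ p = l"
  proof (rule LIMSEQ_unique)
    show "(\<lambda>n. X (Suc n)) \<longlonglongrightarrow> l"
      using l by (rule LIMSEQ_Suc)
    show "(\<lambda>n. X (Suc n)) \<longlonglongrightarrow> l ^ p"
      unfolding X_Suc using l tendsto_const by (rule tendsto_power_strong)
  qed
  have dvd: "int p dvd a ^ (p ^ n) - a" for n
  proof (induction n)
    case (Suc n)
    have "a ^ p ^ Suc n - a = ((a ^ p ^ n) ^ p - a ^ p ^ n) + (a ^ p ^ n - a)"
      by (simp add: mult.commute flip: power_mult)
    then show ?case
      using dvd_add[OF fermat_int Suc, of "a ^ p ^ n"] by (simp only:)
  qed simp
  have "l \<in> padic_ints"
    unfolding padic_ints_def
    by (rule Lim_in_closed_set[OF closed_closure _ _ l])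
       (auto simp: X_def intro!: always_eventually closure_subset[THEN subsetD])
  moreover have y: "(l - of_int a) / of_nat p \<in> padic_ints"
  proof -
    have "(\<lambda>n. inverse (of_nat p) * (X n - of_int a)) \<longlonglongrightarrow> inverse (of_nat p) * (l - of_int a)"
      using l by (intro tendsto_mult tendsto_diff tendsto_const)
    moreover have "inverse (of_nat p) * (X n - of_int a) \<in> \<int>" for n
    proof -
      obtain k where "a ^ (p ^ n) - a = int p * k"
        using dvd by blast
      then have "X n - of_int a = of_nat p * of_int k"
        unfolding X_def by (metis of_int_diff of_int_mult of_int_of_nat_eq)
      moreover have "(of_nat p :: 'a) \<noteq> 0"
        using p_ge_2 by simp
      ultimately show ?thesis
        by (simp flip: mult.assoc)
    qed
    ultimately have "inverse (of_nat p) * (l - of_int a) \<in> padic_ints"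
      unfolding padic_ints_def
      by (intro Lim_in_closed_set[OF closed_closure])
         (auto intro!: always_eventually closure_subset[THEN subsetD])
    then show ?thesis
      by (simp add: divide_inverse mult.commute)
  qed
  moreover have "l ^ (p - 1) = 1"
  proof -
    have "l \<noteq> 0"
    proof
      assume "l = 0"
      have "nabs ((l - of_int a) / of_nat p) \<le> 1"
        using y by (rule nabs_le_1_of_padic_ints)
      then show False
        using nabs_of_int_coprime[OF a] p_ge_2 \<open>l = 0\<close> by (simp add: nabs_divide nabs_p)
    qed
    moreover have "l * l ^ (p - 1) = l"
      using \<open>l ^ p = l\<close> p_ge_2 by (simp flip: power_Suc)
    ultimately show ?thesis
      by simp
  qed
  moreover have "l - of_int a = of_nat p * ((l - of_int a) / of_nat p)"
    using p_ge_2 by simp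
  ultimately show ?thesis
    by blast
qed

lemma teichmuller_exists:
  assumes a: "\<not> int p dvd a"
  shows "\<exists>z::'a. z \<in> padic_ints \<and> z ^ teich_order = 1 \<and> (\<exists>y\<in>padic_ints. z - of_int a = of_nat q * y)"
proof (cases "p = 2")
  case False
  then show ?thesis
    using root_of_unity_congruent_mod_p[OF a] by (simp add: teich_order_def qq_def)
next
  case True
  have int: "of_int k \<in> (padic_ints :: 'a set)" for k
    unfolding padic_ints_def by (intro closure_subset[THEN subsetD]) simp
  have "odd a"
    using a True by simp
  then have "4 dvd 1 - a \<or> 4 dvd - 1 - a"
    by presburger
  then obtain e k where "e = 1 \<or> e = - 1" "e - a = 4 * k"
    by (metis dvdE)
  moreover have "teich_order = 2"
    unfolding teich_order_def using True by simp
  ultimately have "of_int e ^ teich_order = (1::'a)" "of_int e - of_int a = of_nat q * (of_int k :: 'a)"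
    using True by (auto simp: qq_def simp flip: of_int_diff)
  then show ?thesis
    using int by blast
qed

text \<open>Existence and uniqueness resolve the definite description. Conversely,
  \<open>teichmuller_eqI\<close> recognises the value from these two properties, so
  multiplicativity, oddness and periodicity only require checking a candidate.\<close>

lemma teichmuller_props:
  assumes "\<not> int p dvd a"
  shows "T a ^ teich_order = 1" and "nabs (T a - of_int a) \<le> 1 / real q"
proof -
  have close: "nabs (z - of_int a) \<le> 1 / real q"
    if "\<exists>y\<in>padic_ints. z - of_int a = of_nat q * y" for z :: 'a
    using that nabs_le_1_of_padic_ints by (auto simp: nabs_mult nabs_q intro!: divide_right_mono)
  have "\<exists>!z::'a. z \<in> padic_ints \<and> z ^ teich_order = 1 \<and> (\<exists>y\<in>padic_ints. z - of_int a = of_nat q * y)"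
  proof (rule ex_ex1I[OF teichmuller_exists[OF assms]])
    fix z w :: 'a
    assume z: "z \<in> padic_ints \<and> z ^ teich_order = 1 \<and> (\<exists>y\<in>padic_ints. z - of_int a = of_nat q * y)"
      and w: "w \<in> padic_ints \<and> w ^ teich_order = 1 \<and> (\<exists>y\<in>padic_ints. w - of_int a = of_nat q * y)"
    have "nabs (of_int a - w) \<le> 1 / real q"
      using close[of w] w by (subst nabs_minus_commute) blast
    moreover have "nabs (z - of_int a) \<le> 1 / real q"
      using close[of z] z by blast
    ultimately have "nabs (z - w) \<le> 1 / real q"
      by (rule nabs_diff_le_trans[rotated])
    then show "z = w"
      using root_of_unity_unique z w by blast
  qed
  from theI'[OF this] assms
  show "T a ^ teich_order = 1" "nabs (T a - of_int a) \<le> 1 / real q"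
    using close[of "T a"] by (auto simp: teichmuller_def teich_order_def)
qed

lemma teichmuller_eqI:
  assumes "\<not> int p dvd a" "z ^ teich_order = 1" "nabs (z - of_int a) \<le> 1 / real q"
  shows "T a = z"
proof (rule root_of_unity_unique)
  have "nabs (of_int a - z) \<le> 1 / real q"
    using assms(3) by (subst nabs_minus_commute)
  with teichmuller_props(2)[OF assms(1)] show "nabs (T a - z) \<le> 1 / real q"
    by (rule nabs_diff_le_trans)
qed (use assms teichmuller_props(1) in auto)

lemma nabs_teichmuller: "\<not> int p dvd a \<Longrightarrow> nabs (T a) = 1"
  using teichmuller_props(1) teich_order_pos nabs_root_of_unity by blast

lemma teichmuller_neq_0: "\<not> int p dvd a \<Longrightarrow> T a \<noteq> 0"
  using nabs_teichmuller by force

lemma not_dvd_mult: "\<not> int p dvd a \<Longrightarrow> \<not> int p dvd b \<Longrightarrow> \<not> int p dvd a * b"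
  using prime_p by (simp add: prime_dvd_mult_iff)

lemma teichmuller_mult:
  assumes "\<not> int p dvd a" "\<not> int p dvd b"
  shows "T (a * b) = T a * T b"
proof (rule teichmuller_eqI)
  have "nabs ((T a - of_int a) * T b + of_int a * (T b - of_int b)) \<le> 1 / real q"
    using assms teichmuller_props(2)
    by (intro nabs_add_le) (auto simp: nabs_mult nabs_teichmuller nabs_of_int_coprime)
  then show "nabs (T a * T b - of_int (a * b)) \<le> 1 / real q"
    by (simp add: algebra_simps)
qed (use assms teichmuller_props(1) not_dvd_mult in \<open>auto simp: power_mult_distrib\<close>)

text \<open>Serves to show that \<open>- T a\<close> is again a root of unity of the right order, so
  that the Teichmueller character is odd.\<close>

lemma even_teich_order: "even teich_order"
proof (cases "p = 2")
  case False
  then have "odd p"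
    using prime_p p_ge_2 prime_odd_nat[of p] by simp
  then show ?thesis
    by (simp add: teich_order_def)
next
  case True
  then show ?thesis
    unfolding teich_order_def by simp
qed

lemma teichmuller_uminus:
  assumes "\<not> int p dvd a"
  shows "T (- a) = - T a"
proof (rule teichmuller_eqI)
  show "nabs (- T a - of_int (- a)) \<le> 1 / real q"
    using teichmuller_props(2)[OF assms] nabs_minus[of "T a - of_int a"] by simp
qed (use assms teichmuller_props(1) even_teich_order in auto)

lemma teichmuller_add_multiple:
  assumes "\<not> int p dvd a" "int q dvd m"
  shows "T (a + m) = T a"
proof (rule teichmuller_eqI)
  have "int p dvd m"
    using assms(2) p_dvd_q by (meson dvd_trans of_nat_dvd_iff)
  then show "\<not> int p dvd a + m"
    using assms(1) by (simp add: dvd_add_left_iff)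
  have "nabs (T a - of_int a - of_int m) \<le> 1 / real q"
    using teichmuller_props(2)[OF assms(1)] nabs_of_int_dvd[OF assms(2)]
    by (rule nabs_diff_le[OF _ order_trans]) (simp_all add: nabs_q)
  then show "nabs (T a - of_int (a + m)) \<le> 1 / real q"
    by (simp add: algebra_simps)
qed (use assms teichmuller_props(1) in auto)

section \<open>The unit part of an integer and its p-adic powers\<close>

abbreviation A :: "int \<Rightarrow> 'a" where "A \<equiv> angle p"

abbreviation P :: "int \<Rightarrow> 'a \<Rightarrow> 'a" where "P \<equiv> angle_pow p"

lemma nabs_angle_minus_1:
  assumes "\<not> int p dvd a"
  shows "nabs (A a - 1) \<le> 1 / real q"
proof -
  have "A a - 1 = (of_int a - T a) / T a"
    using teichmuller_neq_0[OF assms] by (simp add: angle_def diff_divide_distrib)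
  then show ?thesis
    using teichmuller_props(2)[OF assms] nabs_teichmuller[OF assms]
    by (simp add: nabs_divide nabs_minus_commute[of "of_int a"])
qed

lemma angle_mult:
  "\<not> int p dvd a \<Longrightarrow> \<not> int p dvd b \<Longrightarrow> A (a * b) = A a * A b"
  by (simp add: angle_def teichmuller_mult)

lemma angle_pow_eq: "P a u = binomial_series u (A a - 1)"
  by (simp add: angle_pow_def binomial_series_def)

lemma nabs_angle_pow_le_1:
  "\<not> int p dvd a \<Longrightarrow> u \<in> disc \<Longrightarrow> nabs (P a u) \<le> 1"
  unfolding angle_pow_eq by (intro nabs_binomial_series_le_1 nabs_angle_minus_1)

lemma angle_pow_add:
  "\<not> int p dvd a \<Longrightarrow> u \<in> disc \<Longrightarrow> v \<in> disc \<Longrightarrow> P a (u + v) = P a u * P a v"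
  unfolding angle_pow_eq by (intro binomial_series_add nabs_angle_minus_1)

lemma angle_pow_1: "P a 1 = A a"
  using binomial_series_of_nat[of 1 "A a - 1"] by (simp add: angle_pow_eq)

lemma angle_pow_0: "P a 0 = 1"
  using binomial_series_of_nat[of 0 "A a - 1"] by (simp add: angle_pow_eq)

lemma nabs_angle_pow_minus_1:
  assumes "\<not> int p dvd a" "u \<in> disc"
  shows "nabs (P a u - 1) \<le> nabs u"
proof -
  have "nabs (P a u - 1) \<le> nabs u * (nabs (A a - 1) * real q)"
    unfolding angle_pow_eq using assms by (intro nabs_binomial_series_minus_1 nabs_angle_minus_1)
  also have "\<dots> \<le> nabs u * 1"
    using nabs_angle_minus_1[OF assms(1)] q_gt_1 by (intro mult_left_mono) (auto simp: field_simps)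
  finally show ?thesis
    by simp
qed

lemma angle_pow_mult:
  assumes "\<not> int p dvd a" "\<not> int p dvd b" "u \<in> disc"
  shows "P (a * b) u = P a u * P b u"
  using binomial_series_mult[OF assms(3) nabs_angle_minus_1[OF assms(1)] nabs_angle_minus_1[OF assms(2)]]
  by (simp add: angle_pow_eq angle_mult[OF assms(1,2)] algebra_simps)

lemma nabs_multiple_quotient_le:
  assumes "\<not> int p dvd a" "int m dvd k"
  shows "nabs (of_int k / of_int a :: 'a) \<le> nabs (of_nat m :: 'a)"
  using nabs_of_int_coprime[OF assms(1)] nabs_of_int_dvd[OF assms(2)] by (simp add: nabs_divide)

text \<open>A shift by a multiple of q does not change the Teichmueller value, so the unit part is
  multiplied by 1 + m / a. This makes the dependence on m a binomial series.\<close>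

lemma angle_pow_add_multiple:
  assumes "\<not> int p dvd a" "int q dvd m" "u \<in> disc"
  shows "P (a + m) u = P a u * binomial_series u (of_int m / of_int a)"
proof -
  have "a \<noteq> 0"
    using assms(1) by auto
  have "nabs (of_int m / of_int a :: 'a) \<le> 1 / real q"
    using nabs_multiple_quotient_le[OF assms(1,2)] by (simp add: nabs_q)
  from binomial_series_mult[OF assms(3) nabs_angle_minus_1[OF assms(1)] this]
  have "P a u * binomial_series u (of_int m / of_int a)
      = binomial_series u (A a - 1 + of_int m / of_int a + (A a - 1) * (of_int m / of_int a))"
    unfolding angle_pow_eq by (rule sym)
  also have "A a - 1 + of_int m / of_int a + (A a - 1) * (of_int m / of_int a)
      = A a + A a * (of_int m / of_int a) - 1"
    by (simp only: left_diff_distrib mult_1_left) simp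
  also have "A a + A a * (of_int m / of_int a) = A (a + m)"
    using \<open>a \<noteq> 0\<close> by (simp add: angle_def teichmuller_add_multiple[OF assms(1,2)] add_divide_distrib)
  finally show ?thesis
    by (simp add: angle_pow_eq)
qed

end

subsection \<open>Bernoulli numbers\<close>

text \<open>The quotient of power series is exact because divisor and dividend both have order 1 at
  0.\<close>

lemma bernoulli_fps_mult:
  "fps_X / (fps_exp 1 - 1) * (fps_exp 1 - 1) = (fps_X :: rat fps)"
proof (rule fps_times_divide_eq)
  have "subdegree (fps_exp 1 - 1 :: rat fps) = 1"
    by (rule subdegreeI) auto
  then show "fps_exp 1 - 1 \<noteq> (0 :: rat fps)"
    "subdegree (fps_exp 1 - 1 :: rat fps) \<le> subdegree (fps_X :: rat fps)"
    by auto
qed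

lemma fps_exp_sum:
  "(\<Sum>x<N. fps_exp (of_nat x)) * (fps_exp 1 - 1) = fps_exp (of_nat N :: 'a::field_char_0) - 1"
proof (induction N)
  case (Suc N)
  then show ?case
    using fps_exp_add_mult[of 1 "of_nat N :: 'a"] by (simp add: algebra_simps)
qed simp

text \<open>Faulhaber's formula: the exponentials with exponents 0, ..., N - 1 form a geometric sum,
  so multiplying by X is the same as multiplying exp(N X) - 1 by the Bernoulli generating function;
  then the coefficients of degree j + 1 are compared.\<close>

lemma sum_powers_bernoulli:
  "(\<Sum>x<N. of_nat x ^ j) =
    (\<Sum>i\<le>j. of_nat (j choose i) * bernoulli_number i * of_nat N ^ (Suc j - i) / of_nat (Suc j - i))"
proof -
  define b :: "rat fps" where "b = fps_X / (fps_exp 1 - 1)"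
  have "fps_X * (\<Sum>x<N. fps_exp (of_nat x)) =
      b * ((\<Sum>x<N. fps_exp (of_nat x)) * (fps_exp 1 - 1))"
    using bernoulli_fps_mult by (metis b_def mult.assoc mult.commute)
  then have "fps_nth (fps_X * (\<Sum>x<N. fps_exp (of_nat x))) (Suc j) =
      fps_nth (b * (fps_exp (of_nat N) - 1)) (Suc j)"
    by (simp only: fps_exp_sum)
  then have "(\<Sum>x<N. of_nat x ^ j) / fact j = fps_nth (b * (fps_exp (of_nat N) - 1)) (Suc j)"
    by (simp add: fps_sum_nth sum_divide_distrib)
  also have "\<dots> = (\<Sum>i\<le>j. fps_nth b i * (of_nat N ^ (Suc j - i) / fact (Suc j - i)))"
    by (simp add: fps_mult_nth atLeast0AtMost Suc_diff_le)
  finally have "(\<Sum>x<N. of_nat x ^ j) =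
      (\<Sum>i\<le>j. fact j * (fps_nth b i * (of_nat N ^ (Suc j - i) / fact (Suc j - i))))"
    unfolding sum_distrib_left[symmetric] by (simp add: field_simps)
  also have "\<dots> = (\<Sum>i\<le>j. of_nat (j choose i) * bernoulli_number i * of_nat N ^ (Suc j - i) / of_nat (Suc j - i))"
  proof (rule sum.cong)
    fix i assume "i \<in> {..j}"
    then have "i \<le> j" by simp
    then have "Suc j - i = Suc (j - i)"
      by (simp add: Suc_diff_le)
    then have "(fact (Suc j - i) :: rat) = of_nat (Suc j - i) * fact (j - i)"
      by simp
    then show "fact j * (fps_nth b i * (of_nat N ^ (Suc j - i) / fact (Suc j - i))) =
        of_nat (j choose i) * bernoulli_number i * of_nat N ^ (Suc j - i) / of_nat (Suc j - i)"
      using \<open>i \<le> j\<close> by (simp add: binomial_fact bernoulli_number_def b_def mult_ac)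
  qed simp
  finally show ?thesis .
qed

context padic
begin

abbreviation B :: "nat \<Rightarrow> 'a" where "B j \<equiv> of_rat (bernoulli_number j)"

definition power_mean :: "nat \<Rightarrow> nat \<Rightarrow> 'a" where
  "power_mean N j = (\<Sum>x<N. of_nat x ^ j) / of_nat N"

text \<open>Faulhaber's formula divided by N: the term i = j is the Bernoulli number, and all others
  keep a positive power of N.\<close>

lemma power_mean_eq:
  assumes "N > 0"
  shows "power_mean N j =
    B j + (\<Sum>i<j. of_nat (j choose i) * B i * (of_nat N ^ (j - i) / of_nat (Suc (j - i))))"
proof -
  have "(\<Sum>x<N. of_nat x ^ j :: 'a) = of_rat (\<Sum>x<N. of_nat x ^ j)"
    by (simp add: of_rat_sum of_rat_power)
  also have "\<dots> = (\<Sum>i\<le>j. of_nat (j choose i) * B i * of_nat N ^ (Suc j - i) / of_nat (Suc j - i))"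
    unfolding sum_powers_bernoulli
    by (simp add: of_rat_sum of_rat_power of_rat_mult of_rat_divide del: of_nat_Suc of_nat_diff)
  also have "\<dots> = (\<Sum>i\<le>j. of_nat (j choose i) * B i * (of_nat N ^ (j - i) / of_nat (Suc (j - i)))) * of_nat N"
    unfolding sum_distrib_right
    by (rule sum.cong) (auto simp: Suc_diff_le simp del: of_nat_Suc)
  finally have "power_mean N j =
      (\<Sum>i\<le>j. of_nat (j choose i) * B i * (of_nat N ^ (j - i) / of_nat (Suc (j - i))))"
    using assms by (simp add: power_mean_def)
  also have "{..j} = insert j {..<j}"
    by auto
  finally show ?thesis
    by simp
qed

text \<open>The denominator m + 1 may be divisible by p, but costs at most m + 1 \<le> 2^m. Since
  |N| \<le> 1/2, the spare m - 1 factors |N| pay for all of this except one factor 2.\<close>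

lemma nabs_power_div_Suc_le:
  assumes "p dvd N" "m > 0"
  shows "nabs (of_nat N ^ m / of_nat (Suc m) :: 'a) \<le> 2 * nabs (of_nat N :: 'a)"
proof -
  define a where "a = nabs (of_nat N :: 'a)"
  have "a \<le> 1 / real p"
    using nabs_of_nat_multiple[OF assms(1)] by (simp add: a_def nabs_p)
  also have "\<dots> \<le> 1 / 2"
    using p_ge_2 by (simp add: field_simps)
  finally have a: "a \<le> 1 / 2" "a \<ge> 0"
    by (auto simp: a_def)
  have "Suc m \<le> 2 ^ m"
    using less_exp[of m] by (simp add: Suc_le_eq)
  then have "real (Suc m) \<le> 2 ^ m"
    by (metis of_nat_le_iff of_nat_numeral of_nat_power)
  moreover have "1 / real (Suc m) \<le> nabs (of_nat (Suc m) :: 'a)"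
    by (rule nabs_of_nat_ge) simp
  then have "inverse (nabs (of_nat (Suc m) :: 'a)) \<le> inverse (1 / real (Suc m))"
    by (intro le_imp_inverse_le) auto
  ultimately have inv: "inverse (nabs (of_nat (Suc m) :: 'a)) \<le> 2 ^ m"
    by simp
  have "nabs (of_nat N ^ m / of_nat (Suc m) :: 'a) = a * a ^ (m - 1) * inverse (nabs (of_nat (Suc m) :: 'a))"
    using assms(2) by (simp add: nabs_mult nabs_inverse nabs_power a_def divide_inverse flip: power_Suc del: of_nat_Suc)
  also have "\<dots> \<le> a * (1 / 2) ^ (m - 1) * 2 ^ m"
    using a inv by (intro mult_mono power_mono) auto
  also have "\<dots> = 2 * a"
    using assms(2) by (cases m) (auto simp: power_one_over)
  finally show ?thesis
    by (simp add: a_def)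
qed

text \<open>A weak form of the von Staudt-Clausen theorem: p B_j is p-integral. Taking N = p, the
  mean has size at most p, and the correction terms, by induction, do too because 2 |p| \<le>
  1.\<close>

lemma nabs_bernoulli_le: "nabs (B j) \<le> real p"
proof (induction j rule: less_induct)
  case (less j)
  have "nabs (power_mean p j - (\<Sum>i<j. of_nat (j choose i) * B i * (of_nat p ^ (j - i) / of_nat (Suc (j - i))))) \<le> real p"
  proof (intro nabs_diff_le nabs_sum_le)
    have "nabs (\<Sum>x<p. of_nat x ^ j :: 'a) \<le> 1"
      by (intro nabs_sum_le) (auto simp: nabs_power nabs_of_nat_le_1 power_le_one)
    then show "nabs (power_mean p j) \<le> real p"
      using p_ge_2 by (simp add: power_mean_def nabs_divide nabs_p mult_le_cancel_right2)
    fix i assume i: "i \<in> {..<j}"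
    have "2 * nabs (of_nat p :: 'a) \<le> 1"
      using p_ge_2 by (simp add: nabs_p)
    then have "nabs (of_nat p ^ (j - i) / of_nat (Suc (j - i)) :: 'a) \<le> 1"
      using nabs_power_div_Suc_le[of p "j - i"] i by simp
    then have "nabs (of_nat (j choose i) * B i * (of_nat p ^ (j - i) / of_nat (Suc (j - i)))) \<le> 1 * real p * 1"
      unfolding nabs_mult using less i by (intro mult_mono nabs_of_nat_le_1) auto
    then show "nabs (of_nat (j choose i) * B i * (of_nat p ^ (j - i) / of_nat (Suc (j - i)))) \<le> real p"
      by simp
  qed simp
  then show ?case
    using power_mean_eq[of p j] p_ge_2 by simp
qed

lemma nabs_power_mean_diff_le:
  assumes "p dvd N" "N > 0"
  shows "nabs (power_mean N j - B j) \<le> real p * (2 * nabs (of_nat N :: 'a))"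
  unfolding power_mean_eq[OF assms(2)] add_diff_cancel_left'
proof (rule nabs_sum_le)
  fix i assume i: "i \<in> {..<j}"
  have "nabs (of_nat (j choose i) * B i * (of_nat N ^ (j - i) / of_nat (Suc (j - i))))
      \<le> 1 * real p * (2 * nabs (of_nat N :: 'a))"
    unfolding nabs_mult[of "_ * _" "_ / _"] nabs_mult[of "of_nat _" "B _"]
    using i assms by (intro mult_mono nabs_of_nat_le_1 nabs_bernoulli_le nabs_power_div_Suc_le) auto
  then show "nabs (of_nat (j choose i) * B i * (of_nat N ^ (j - i) / of_nat (Suc (j - i))))
      \<le> real p * (2 * nabs (of_nat N :: 'a))"
    by simp
qed simp

text \<open>Exactness for j = 0 matters: this is the only term of the binomial series without a
  factor u.\<close>

lemma power_mean_0: "N > 0 \<Longrightarrow> power_mean N 0 = B 0"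
  using power_mean_eq[of N 0] by simp

end

lemma int_div_less:
  assumes "x < n * m" "0 < (m::int)"
  shows "x div m < n"
proof (rule ccontr)
  assume "\<not> x div m < n"
  then have "n * m \<le> (x div m) * m"
    using assms(2) by (intro mult_right_mono) auto
  also have "\<dots> \<le> x"
    using div_mult_mod_eq[of x m] pos_mod_sign[OF assms(2), of x] by linarith
  finally show False
    using assms(1) by simp
qed

section \<open>Bernoulli series as limits of means\<close>

lemma suminf_diff_nonarch:
  fixes g h :: "nat \<Rightarrow> 'a::nonarch_complete_field"
  assumes "summable g" "summable h"
  shows "suminf g - suminf h = (\<Sum>j. g j - h j)" and "summable (\<lambda>j. g j - h j)"
proof -
  have "(\<lambda>j. g j - h j) sums (suminf g - suminf h)"
    using tendsto_diff[OF summable_LIMSEQ[OF assms(1)] summable_LIMSEQ[OF assms(2)]]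
    by (simp add: sums_def sum_subtractf)
  then show "suminf g - suminf h = (\<Sum>j. g j - h j)" "summable (\<lambda>j. g j - h j)"
    by (auto simp: sums_unique sums_summable)
qed

context padic
begin

text \<open>The Volkenborn integral over x of (1 + F x / a)^u, and the inner series of the formula
  for the L-function.\<close>

definition bernoulli_series :: "nat \<Rightarrow> int \<Rightarrow> 'a \<Rightarrow> 'a" where
  "bernoulli_series F a u = (\<Sum>j. (u gchoose j) * (of_nat F / of_int a) ^ j * B j)"

text \<open>Averaging over x replaces \<open>B j\<close> by \<open>power_mean N j\<close> in each
  term. The terms with j = 0 agree exactly, and the others are errors of size O(N) with a factor
  |u|.\<close>

lemma bernoulli_series_approx:
  assumes F: "q dvd F" and a: "\<not> int p dvd a" and N: "p dvd N" "N > 0" and u: "u \<in> disc"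
  shows "nabs ((\<Sum>x<N. binomial_series u (of_nat F * of_nat x / of_int a)) / of_nat N
      - bernoulli_series F a u) \<le> nabs u * (real p * (2 * nabs (of_nat N :: 'a)))"
proof -
  define y :: 'a where "y = of_nat F / of_int a"
  have y: "nabs y \<le> 1 / real q"
    using nabs_multiple_quotient_le[OF a, of q "int F"] F by (simp add: y_def nabs_q)
  have yx: "nabs (y * of_nat x) \<le> 1 / real q" for x
    unfolding nabs_mult using y nabs_of_nat_le_1[of x, where 'a = 'a]
    by (meson mult_left_le nabs_nonneg order_trans)
  have "(\<Sum>x<N. binomial_series u (y * of_nat x)) = (\<Sum>j. \<Sum>x<N. (u gchoose j) * (y * of_nat x) ^ j)"
    unfolding binomial_series_def
    by (intro suminf_sum[symmetric] binomial_series_summable u yx)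
  moreover have sum1: "summable (\<lambda>j. \<Sum>x<N. (u gchoose j) * (y * of_nat x) ^ j)"
    by (intro summable_sum binomial_series_summable u yx)
  moreover have "inverse (of_nat N) * (\<Sum>x<N. (u gchoose j) * (y * of_nat x) ^ j)
      = (u gchoose j) * y ^ j * power_mean N j" for j
    by (simp add: power_mean_def divide_inverse power_mult_distrib sum_distrib_left mult_ac)
  ultimately have mean: "(\<Sum>x<N. binomial_series u (y * of_nat x)) / of_nat N
      = (\<Sum>j. (u gchoose j) * y ^ j * power_mean N j)"
    and sum_mean: "summable (\<lambda>j. (u gchoose j) * y ^ j * power_mean N j)"
    using suminf_cmult[OF sum1, of "inverse (of_nat N)"] summable_cmult[OF sum1, of "inverse (of_nat N)"]
    by (simp_all add: divide_inverse mult.commute)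
  obtain R where R: "nabs u \<le> R" "1 \<le> R" "R < real q * fact_radius"
    using u by (rule disc_radius)
  have sum_B: "summable (\<lambda>j. (u gchoose j) * y ^ j * B j)"
  proof (rule geometric_summable[of _ "real p" "rho R"])
    fix j
    have "nabs ((u gchoose j) * y ^ j * B j) \<le> rho R ^ j * real p"
      unfolding nabs_mult[of "_ * _" "B j"]
      using nabs_binomial_term_le(1)[OF R(1,2), of y 1 j] y rho_bounds[OF R(2,3)]
      by (intro mult_mono nabs_bernoulli_le) auto
    then show "nabs ((u gchoose j) * y ^ j * B j) \<le> real p * rho R ^ j"
      by (simp add: mult.commute)
  qed (use rho_bounds[OF R(2,3)] in auto)
  have "nabs ((\<Sum>j. (u gchoose j) * y ^ j * power_mean N j) - (\<Sum>j. (u gchoose j) * y ^ j * B j))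
      \<le> nabs u * (real p * (2 * nabs (of_nat N :: 'a)))"
    unfolding suminf_diff_nonarch(1)[OF sum_mean sum_B]
  proof (rule nabs_suminf_le[OF suminf_diff_nonarch(2)[OF sum_mean sum_B]])
    fix j
    show "nabs ((u gchoose j) * y ^ j * power_mean N j - (u gchoose j) * y ^ j * B j)
        \<le> nabs u * (real p * (2 * nabs (of_nat N :: 'a)))"
    proof (cases "j = 0")
      case False
      have "rho R ^ j \<le> 1"
        using rho_bounds[OF R(2,3)] by (intro power_le_one) auto
      then have "nabs u * rho R ^ j \<le> nabs u"
        by (simp add: mult_left_le)
      then have le: "nabs ((u gchoose j) * y ^ j) \<le> nabs u"
        using nabs_binomial_term_le(2)[OF R(1,2), of y 1 j] y False by simp
      show ?thesis
        unfolding right_diff_distrib[symmetric] nabs_mult[of "_ * _" "_ - _"]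
        using N le by (intro mult_mono nabs_power_mean_diff_le) auto
    qed (use N power_mean_0 in simp)
  qed
  then show ?thesis
    using mean by (simp add: y_def bernoulli_series_def)
qed

section \<open>Sums over residues prime to p, and their permutation by multiplication with c\<close>

definition units_upto :: "nat \<Rightarrow> int set" where
  "units_upto M = {a. 1 \<le> a \<and> a \<le> int M \<and> \<not> int p dvd a}"

lemma finite_units_upto [simp]: "finite (units_upto M)"
  by (rule finite_subset[of _ "{1..int M}"]) (auto simp: units_upto_def)

lemma sum_units_upto_mult:
  assumes "p dvd F" "F > 0"
  shows "(\<Sum>a\<in>units_upto (F * N). h a) = (\<Sum>a\<in>units_upto F. \<Sum>x<N. h (a + int F * int x))"
proof -
  have "(\<Sum>a\<in>units_upto (F * N). h a)
      = (\<Sum>(a, x)\<in>units_upto F \<times> {..<N}. h (a + int F * int x))"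
  proof (rule sum.reindex_bij_witness[of _ "\<lambda>(a, x). a + int F * int x"
        "\<lambda>b. ((b - 1) mod int F + 1, nat ((b - 1) div int F))"])
    \<comment> \<open>Quotient and remainder are taken of b - 1, because the representatives run
      from 1 to F instead of from 0 to F - 1.\<close>
    fix b assume b: "b \<in> units_upto (F * N)"
    then have pos: "(b - 1) div int F \<ge> 0"
      using assms(2) by (simp add: units_upto_def pos_imp_zdiv_nonneg_iff)
    show *: "(case ((b - 1) mod int F + 1, nat ((b - 1) div int F)) of
        (a, x) \<Rightarrow> a + int F * int x) = b"
      using pos by simp
    then have eq: "b = ((b - 1) mod int F + 1) + int F * ((b - 1) div int F)"
      by simp
    have "\<not> int p dvd (b - 1) mod int F + 1"
    proof
      assume "int p dvd (b - 1) mod int F + 1"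
      moreover have "int p dvd int F * ((b - 1) div int F)"
        using assms(1) by simp
      ultimately have "int p dvd b"
        by (subst eq) (rule dvd_add)
      then show False
        using b by (simp add: units_upto_def)
    qed
    moreover have "(b - 1) mod int F < int F" "0 \<le> (b - 1) mod int F"
      using assms(2) by auto
    moreover have "(b - 1) div int F < int N"
      using b assms(2) by (intro int_div_less) (auto simp: units_upto_def mult.commute)
    ultimately show "((b - 1) mod int F + 1, nat ((b - 1) div int F)) \<in> units_upto F \<times> {..<N}"
      using pos by (auto simp: units_upto_def)
    show "(case ((b - 1) mod int F + 1, nat ((b - 1) div int F)) of
        (a, x) \<Rightarrow> h (a + int F * int x)) = h b"
      using * by simp
  next
    fix z assume "z \<in> units_upto F \<times> {..<N}"
    then obtain a x where z: "z = (a, x)" "a \<in> units_upto F" "x < N"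
      by auto
    then have a: "0 \<le> a - 1" "a - 1 < int F" "\<not> int p dvd a"
      by (auto simp: units_upto_def)
    have "(a - 1 + int F * int x) mod int F = a - 1" "(a - 1 + int F * int x) div int F = int x"
      using a by (simp_all add: assms(2))
    then show "(((case z of (a, x) \<Rightarrow> a + int F * int x) - 1) mod int F + 1,
        nat (((case z of (a, x) \<Rightarrow> a + int F * int x) - 1) div int F)) = z"
      by (simp add: z algebra_simps)
    have "int F * int x + int F \<le> int F * int N"
    proof -
      have "int F * (int x + 1) \<le> int F * int N"
        using z(3) by (intro mult_left_mono) auto
      then show ?thesis
        by (simp add: algebra_simps)
    qed
    moreover have "1 \<le> a + int F * int x"
      using a add_increasing2[of "int F * int x" 1 a] by simp
    moreover have "\<not> int p dvd a + int F * int x"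
      using a assms(1) by (simp add: dvd_add_left_iff)
    ultimately show "(case z of (a, x) \<Rightarrow> a + int F * int x) \<in> units_upto (F * N)"
      using a by (auto simp: units_upto_def z)
  qed
  then show ?thesis
    by (simp add: sum.cartesian_product)
qed

text \<open>
  The quantity \<open>k = carry c M b\<close> is the one with \<open>c a = b + M k\<close> when \<open>a\<close> and \<open>b\<close> are
  representatives modulo \<open>M\<close> with \<open>c a \<equiv> b\<close>.
\<close>

definition carry :: "int \<Rightarrow> int \<Rightarrow> int \<Rightarrow> int" where
  "carry c M b = (- b * modular_inverse c M) mod c"

text \<open>M is invertible modulo c, so the divisibility fixes k modulo c and the range fixes
  k.\<close>

lemma carry_eqI:
  assumes "coprime c M" "c > 1" "c dvd b + M * k" "0 \<le> k" "k < c"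
  shows "carry c M b = k"
proof -
  have inv: "[M * modular_inverse c M = 1] (mod c)"
    using assms(1) by (intro cong_modular_inverse1) (simp add: coprime_commute)
  have "[- b = M * k] (mod c)"
    using assms(3) dvd_minus_iff[of c "b + M * k"] by (simp add: cong_iff_dvd_diff algebra_simps)
  then have "[- b * modular_inverse c M = M * k * modular_inverse c M] (mod c)"
    by (rule cong_scalar_right)
  also have "M * k * modular_inverse c M = k * (M * modular_inverse c M)"
    by simp
  also have "[\<dots> = k * 1] (mod c)"
    using inv by (rule cong_scalar_left)
  finally show ?thesis
    using assms(4,5) by (simp add: carry_def cong_def)
qed

lemma dvd_add_carry:
  assumes "coprime c M" "c > 1"
  shows "c dvd b + M * carry c M b"
proof -
  have "[M * modular_inverse c M = 1] (mod c)"
    using assms(1) by (intro cong_modular_inverse1) (simp add: coprime_commute)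
  then have "[- b * (M * modular_inverse c M) = - b * 1] (mod c)"
    by (rule cong_scalar_left)
  moreover have "[M * carry c M b = M * (- b * modular_inverse c M)] (mod c)"
    unfolding carry_def by (rule cong_scalar_left) simp
  ultimately have "[M * carry c M b = - b] (mod c)"
    by (simp add: mult_ac) (metis cong_trans)
  then show ?thesis
    by (simp add: cong_iff_dvd_diff add.commute)
qed

text \<open>Dividing c a by M leaves a remainder b and a quotient k between 0 and c - 1 for which c
  divides b + M k; \<open>carry_eqI\<close> thus recovers k from b alone. Backwards, a is (b + M k)
  / c.\<close>

lemma sum_units_upto_carry:
  assumes "p dvd M" "M > 0" and c: "coprime c (int M)" "c > 1"
  shows "(\<Sum>a\<in>units_upto M. h (c * a)) = (\<Sum>b\<in>units_upto M. h (b + int M * carry c (int M) b))"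
proof (rule sum.reindex_bij_witness[of _ "\<lambda>b. (b + int M * carry c (int M) b) div c" "\<lambda>a. (c * a) mod int M"])
  fix a assume a: "a \<in> units_upto M"
  have pM: "int p dvd int M"
    using assms(1) by simp
  \<comment> \<open>The endpoint M is divisible by p and so does not occur; a < M is what keeps the
    quotient below c.\<close>
  have "a \<noteq> int M"
    using a pM by (auto simp: units_upto_def)
  then have a': "1 \<le> a" "a < int M" "\<not> int p dvd a"
    using a by (auto simp: units_upto_def)
  have "coprime c (int p)"
    using c(1) pM by (meson coprime_divisors dvd_refl)
  then have "\<not> int p dvd c"
    by (rule not_dvd_of_coprime)
  then have not_dvd: "\<not> int p dvd c * a"
    using a' not_dvd_mult by blast
  have dm: "(c * a) mod int M + int M * (c * a div int M) = c * a"
    by simp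
  have carry: "carry c (int M) (c * a mod int M) = c * a div int M"
  proof (rule carry_eqI[OF c])
    show "c dvd c * a mod int M + int M * (c * a div int M)"
      by (simp only: dm dvd_triv_left)
    show "0 \<le> c * a div int M"
      using a' c assms(2) by (simp add: pos_imp_zdiv_nonneg_iff)
    show "c * a div int M < c"
      using a' c assms(2) by (intro int_div_less) auto
  qed
  show "(c * a mod int M + int M * carry c (int M) (c * a mod int M)) div c = a"
    unfolding carry dm using c by simp
  show "h (c * a mod int M + int M * carry c (int M) (c * a mod int M)) = h (c * a)"
    unfolding carry dm ..
  have "\<not> int p dvd c * a mod int M"
    using not_dvd pM by (simp add: dvd_mod_iff)
  moreover from this have "c * a mod int M \<noteq> 0"
    by (metis dvd_0_right)
  moreover have "0 \<le> c * a mod int M" "c * a mod int M < int M"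
    using assms(2) by auto
  ultimately show "c * a mod int M \<in> units_upto M"
    by (simp add: units_upto_def)
next
  fix b assume b: "b \<in> units_upto M"
  have pM: "int p dvd int M"
    using assms(1) by simp
  have "b \<noteq> int M"
    using b pM by (auto simp: units_upto_def)
  then have b': "1 \<le> b" "b < int M" "\<not> int p dvd b"
    using b by (auto simp: units_upto_def)
  define k where "k = carry c (int M) b"
  have k: "0 \<le> k" "k < c"
    using c by (auto simp: k_def carry_def)
  define a where "a = (b + int M * k) div c"
  have ca: "c * a = b + int M * k"
    using dvd_add_carry[OF c, of b] by (simp add: a_def k_def)
  show "c * ((b + int M * carry c (int M) b) div c) mod int M = b"
    using ca b' by (simp add: a_def k_def)
  have "int M * k \<ge> 0"
    using k by simp
  then have "c * a > 0"
    using ca b' by simp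
  then have "1 \<le> a"
    using c by (simp add: zero_less_mult_iff)
  moreover have "a \<le> int M"
  proof -
    have "int M * k \<le> int M * (c - 1)"
      using k by (intro mult_left_mono) auto
    then have "c * a < c * int M"
      using ca b' by (simp add: algebra_simps)
    then show ?thesis
      using c by simp
  qed
  moreover have "\<not> int p dvd a"
  proof
    assume "int p dvd a"
    then have "int p dvd b + int M * k"
      by (simp flip: ca)
    then show False
      using b' pM by (simp add: dvd_add_left_iff)
  qed
  ultimately show "(b + int M * carry c (int M) b) div c \<in> units_upto M"
    by (simp add: units_upto_def a_def k_def)
qed

end

subsection \<open>Character sums\<close>

locale padic_character = padic p K for p and K :: "'a::nonarch_complete_field itself" +
  fixes f :: nat and chi :: "int \<Rightarrow> 'a"
  assumes primitive: "primitive_dirichlet_character f chi"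
begin

lemma f_pos: "f > 0"
  using primitive by (simp add: primitive_dirichlet_character_def)

lemma chi_mult: "chi (a * b) = chi a * chi b"
  using primitive by (simp add: primitive_dirichlet_character_def)

lemma chi_eq_0_iff: "chi a = 0 \<longleftrightarrow> \<not> coprime a (int f)"
  using primitive by (simp add: primitive_dirichlet_character_def)

lemma chi_1: "chi 1 = 1"
  using chi_mult[of 1 1] chi_eq_0_iff[of 1] by simp

lemma chi_power: "chi (a ^ n) = chi a ^ n"
  by (induction n) (auto simp: chi_1 chi_mult)

lemma chi_add_multiple:
  assumes "int f dvd m"
  shows "chi (a + m) = chi a"
proof -
  have period: "chi (a + int f) = chi a" for a
    using primitive by (simp add: primitive_dirichlet_character_def)
  have nat: "chi (a + int f * int n) = chi a" for a n
  proof (induction n)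
    case (Suc n)
    then show ?case
      using period[of "a + int f * int n"] by (simp add: algebra_simps)
  qed simp
  obtain k where k: "m = int f * k"
    using assms by blast
  show ?thesis
  proof (cases "k \<ge> 0")
    case True
    then show ?thesis
      using nat[of a "nat k"] k by simp
  next
    case False
    then show ?thesis
      using nat[of "a + m" "nat (- k)"] k by simp
  qed
qed

text \<open>By Euler's theorem the nonzero values are roots of unity.\<close>

lemma nabs_chi_le_1: "nabs (chi a) \<le> 1"
proof (cases "coprime a (int f)")
  case True
  from euler_theorem_int[OF this f_pos] have "int f dvd a ^ totient f - 1"
    by (simp add: cong_iff_dvd_diff)
  from chi_add_multiple[OF this, of 1] have "chi a ^ totient f = 1"
    by (simp add: chi_1 chi_power)
  then show ?thesis
    using nabs_root_of_unity f_pos by (metis order_refl totient_gt_0_iff)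
qed (simp add: chi_eq_0_iff[symmetric])

definition W :: "nat \<Rightarrow> 'a \<Rightarrow> 'a" where
  "W M u = (\<Sum>a\<in>units_upto M. chi a * P a u) / of_nat M"

text \<open>For s other than 1 and u = 1 - s, this is s - 1 times the formula for the L-function; it
  removes the division that fails at s = 1.\<close>

definition G :: "nat \<Rightarrow> 'a \<Rightarrow> 'a" where
  "G F u = (\<Sum>a\<in>units_upto F. chi a * P a u * bernoulli_series F a u) / of_nat F"

lemma not_dvd_units_upto: "a \<in> units_upto M \<Longrightarrow> \<not> int p dvd a"
  by (simp add: units_upto_def)

lemma p_dvd_multiple_q: "q dvd F \<Longrightarrow> p dvd F"
  using p_dvd_q dvd_trans by blast

lemma nabs_chi_angle_pow_le_1:
  "\<not> int p dvd a \<Longrightarrow> u \<in> disc \<Longrightarrow> nabs (chi a * P a u) \<le> 1"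
  unfolding nabs_mult by (intro mult_le_one nabs_chi_le_1 nabs_angle_pow_le_1) auto

lemma padic_L_formula_eq: "padic_L_formula p chi F s = G F (1 - s) / (s - 1)"
  by (simp add: padic_L_formula_def G_def units_upto_def bernoulli_series_def mult_ac)

text \<open>Sorting by residues a modulo F: \<open>chi\<close> sees only a, and the angle power at a
  + F x is \<open>P a u\<close> times (1 + F x / a)^u, whose mean over x < N is close to the
  Bernoulli series. The division by F does no harm, since F stays fixed while N tends to 0
  p-adically.\<close>

lemma W_G_approx:
  assumes F: "q dvd F" "f dvd F" "F > 0" and N: "p dvd N" "N > 0" and u: "u \<in> disc"
  shows "nabs (W (F * N) u - G F u)
    \<le> nabs u * (real p * (2 * nabs (of_nat N :: 'a))) / nabs (of_nat F :: 'a)"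
proof -
  define bs :: "int \<Rightarrow> nat \<Rightarrow> 'a" where
    "bs a x = binomial_series u (of_nat F * of_nat x / of_int a)" for a x
  have "(\<Sum>a\<in>units_upto (F * N). chi a * P a u)
      = (\<Sum>a\<in>units_upto F. \<Sum>x<N. chi a * P a u * bs a x)"
    unfolding sum_units_upto_mult[OF p_dvd_multiple_q[OF F(1)] F(3)]
  proof (intro sum.cong refl)
    fix a x assume "a \<in> units_upto F"
    moreover have "int q dvd int F * int x" "int f dvd int F * int x"
      using F by simp_all
    ultimately show "chi (a + int F * int x) * P (a + int F * int x) u = chi a * P a u * bs a x"
      using u by (simp add: chi_add_multiple angle_pow_add_multiple not_dvd_units_upto bs_def)
  qed
  also have "\<dots> = (\<Sum>a\<in>units_upto F. chi a * P a u * (\<Sum>x<N. bs a x))"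
    by (simp add: sum_distrib_left)
  finally have "W (F * N) u = (\<Sum>a\<in>units_upto F. chi a * P a u * ((\<Sum>x<N. bs a x) / of_nat N)) / of_nat F"
    by (simp add: W_def mult.commute flip: sum_divide_distrib)
  then have "W (F * N) u - G F u = (\<Sum>a\<in>units_upto F.
      chi a * P a u * ((\<Sum>x<N. bs a x) / of_nat N - bernoulli_series F a u)) / of_nat F"
    by (simp add: G_def right_diff_distrib sum_subtractf diff_divide_distrib)
  moreover have "nabs (\<Sum>a\<in>units_upto F.
      chi a * P a u * ((\<Sum>x<N. bs a x) / of_nat N - bernoulli_series F a u))
      \<le> nabs u * (real p * (2 * nabs (of_nat N :: 'a)))"
  proof (rule nabs_sum_le)
    fix a assume "a \<in> units_upto F"
    then have a: "\<not> int p dvd a"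
      by (rule not_dvd_units_upto)
    have "nabs (chi a * P a u * ((\<Sum>x<N. bs a x) / of_nat N - bernoulli_series F a u))
        \<le> 1 * (nabs u * (real p * (2 * nabs (of_nat N :: 'a))))"
      unfolding nabs_mult[of "_ * _" "_ - _"] bs_def
      using F N a u
      by (intro mult_mono bernoulli_series_approx nabs_chi_angle_pow_le_1) auto
    then show "nabs (chi a * P a u * ((\<Sum>x<N. bs a x) / of_nat N - bernoulli_series F a u))
        \<le> nabs u * (real p * (2 * nabs (of_nat N :: 'a)))"
      by simp
  qed simp
  ultimately show ?thesis
    by (simp add: nabs_divide divide_right_mono)
qed

text \<open>Both values are approximated, with error O(p^(-n)), by one and the same mean, taken
  modulo F F' p^n.\<close>

lemma G_independent:
  assumes F: "q dvd F" "f dvd F" "F > 0" and F': "q dvd F'" "f dvd F'" "F' > 0" and u: "u \<in> disc"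
  shows "G F u = G F' u"
proof -
  define C where "C = max (nabs u * (real p * 2) / nabs (of_nat F :: 'a))
    (nabs u * (real p * 2) / nabs (of_nat F' :: 'a))"
  have le: "nabs (W (F1 * (F2 * p ^ n)) u - G F1 u)
      \<le> nabs u * (real p * 2) / nabs (of_nat F1 :: 'a) * (1 / real p) ^ n"
    if F1: "q dvd F1" "f dvd F1" "F1 > 0" and F2: "q dvd F2" "F2 > 0" for F1 F2 n
  proof -
    have "nabs (of_nat (F2 * p ^ n) :: 'a) \<le> 1 * (1 / real p) ^ n"
      unfolding of_nat_mult nabs_mult of_nat_power nabs_power nabs_p
      by (intro mult_right_mono nabs_of_nat_le_1) auto
    then have "nabs u * (real p * (2 * nabs (of_nat (F2 * p ^ n) :: 'a))) / nabs (of_nat F1 :: 'a)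
        \<le> nabs u * (real p * (2 * (1 * (1 / real p) ^ n))) / nabs (of_nat F1 :: 'a)"
      by (intro divide_right_mono mult_left_mono) auto
    moreover have "p dvd F2 * p ^ n" "F2 * p ^ n > 0"
      using p_dvd_multiple_q[OF F2(1)] F2(2) p_ge_2 by auto
    note W_G_approx[OF F1 this u]
    ultimately show ?thesis
      by simp
  qed
  have "nabs (G F u - G F' u) \<le> C * (1 / real p) ^ n" for n
  proof (rule nabs_diff_le_trans)
    have eq: "F' * (F * p ^ n) = F * (F' * p ^ n)"
      by simp
    show "nabs (G F u - W (F * (F' * p ^ n)) u) \<le> C * (1 / real p) ^ n"
      by (subst nabs_minus_commute, intro order_trans[OF le[OF F F'(1,3)]] mult_right_mono)
        (auto simp: C_def)
    show "nabs (W (F * (F' * p ^ n)) u - G F' u) \<le> C * (1 / real p) ^ n"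
      unfolding eq[symmetric]
      by (intro order_trans[OF le[OF F' F(1,3)]] mult_right_mono) (auto simp: C_def)
  qed
  moreover have "(\<lambda>n. C * (1 / real p) ^ n) \<longlonglongrightarrow> 0"
    using p_ge_2 by (intro tendsto_mult_right_zero LIMSEQ_power_zero) auto
  ultimately have "nabs (G F u - G F' u) \<le> 0"
    by (intro LIMSEQ_le_const[of _ 0]) auto
  then show ?thesis
    using nabs_nonneg[of "G F u - G F' u"] nabs_eq_0_iff[of "G F u - G F' u"] by simp
qed

text \<open>For b prime to p and u = 1 - s, this is the twisted character at b divided by the s-th
  power of the unit part, since the unit part divided by b is the inverse Teichmueller
  value.\<close>

definition H :: "int \<Rightarrow> 'a \<Rightarrow> 'a" where
  "H b u = chi b * P b u / of_int b"

text \<open>Since W is divided by M, (1 + M k / b)^u has to be expanded up to second order: the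
  constant terms cancel against W, the linear terms give u H k, and the remainder |u| (|M| q)^2
  loses one factor |M| in the division.\<close>

lemma carry_approx:
  assumes M: "q dvd M" "f dvd M" "M > 0" and c: "coprime c (int M)" "c > 1" and u: "u \<in> disc"
  shows "nabs ((chi c * P c u - 1) * W M u - u * (\<Sum>b\<in>units_upto M. H b u * of_int (carry c (int M) b)))
    \<le> nabs u * (nabs (of_nat M :: 'a) * (real q)\<^sup>2)"
proof -
  define k where "k = carry c (int M)"
  define x :: "int \<Rightarrow> 'a" where "x b = of_int (int M * k b) / of_int b" for b
  define m where "m = nabs (of_nat M :: 'a)"
  have m: "m > 0"
    using M(3) by (simp add: m_def nabs_pos)
  have m_le: "m \<le> 1 / real q"
    using nabs_of_nat_multiple[OF M(1)] by (simp add: m_def nabs_q)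
  have pc: "\<not> int p dvd c"
  proof -
    have "coprime c (int p)"
      using c(1) p_dvd_multiple_q[OF M(1)] by (meson coprime_divisors dvd_refl of_nat_dvd_iff)
    then show ?thesis
      by (rule not_dvd_of_coprime)
  qed
  have x: "nabs (x b) \<le> m" if "\<not> int p dvd b" for b
    using nabs_multiple_quotient_le[OF that, of M "int M * k b"] by (simp add: x_def m_def)
  have "chi c * P c u * (\<Sum>a\<in>units_upto M. chi a * P a u)
      = (\<Sum>a\<in>units_upto M. chi (c * a) * P (c * a) u)"
    unfolding sum_distrib_left using u pc
    by (intro sum.cong) (simp_all add: chi_mult angle_pow_mult not_dvd_units_upto mult_ac)
  also have "\<dots> = (\<Sum>b\<in>units_upto M. chi (b + int M * k b) * P (b + int M * k b) u)"
    unfolding k_def using sum_units_upto_carry[OF p_dvd_multiple_q[OF M(1)] M(3) c] .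
  also have "\<dots> = (\<Sum>b\<in>units_upto M. chi b * P b u * binomial_series u (x b))"
  proof (intro sum.cong refl)
    fix b assume "b \<in> units_upto M"
    moreover have "int q dvd int M * k b" "int f dvd int M * k b"
      using M by simp_all
    ultimately show "chi (b + int M * k b) * P (b + int M * k b) u = chi b * P b u * binomial_series u (x b)"
      using u by (simp add: chi_add_multiple angle_pow_add_multiple not_dvd_units_upto x_def del: of_int_mult)
  qed
  finally have "(chi c * P c u - 1) * W M u
      = (\<Sum>b\<in>units_upto M. chi b * P b u * (binomial_series u (x b) - 1)) / of_nat M"
    by (simp add: W_def left_diff_distrib right_diff_distrib sum_subtractf diff_divide_distrib)
  moreover have "u * (\<Sum>b\<in>units_upto M. H b u * of_int (k b))
      = (\<Sum>b\<in>units_upto M. chi b * P b u * (u * x b)) / of_nat M"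
    unfolding sum_distrib_left sum_divide_distrib
    using M(3) by (intro sum.cong refl) (simp add: H_def x_def field_simps)
  ultimately have "(chi c * P c u - 1) * W M u - u * (\<Sum>b\<in>units_upto M. H b u * of_int (k b))
      = (\<Sum>b\<in>units_upto M. chi b * P b u * (binomial_series u (x b) - (1 + u * x b))) / of_nat M"
    by (simp add: sum_subtractf algebra_simps sum.distrib flip: diff_divide_distrib)
  moreover have "nabs (\<Sum>b\<in>units_upto M. chi b * P b u * (binomial_series u (x b) - (1 + u * x b)))
      \<le> nabs u * (m * real q)\<^sup>2"
  proof (rule nabs_sum_le)
    fix b assume "b \<in> units_upto M"
    then have b: "\<not> int p dvd b"
      by (rule not_dvd_units_upto)
    have "nabs (x b) \<le> 1 / real q"
      using x[OF b] m_le by simp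
    from nabs_binomial_series_tail_le[OF u this, of 2]
    have "nabs (binomial_series u (x b) - (1 + u * x b)) \<le> nabs u * (nabs (x b) * real q)\<^sup>2"
      by (simp add: numeral_2_eq_2)
    also have "\<dots> \<le> nabs u * (m * real q)\<^sup>2"
      using x[OF b] by (intro mult_left_mono power_mono mult_right_mono) auto
    finally have "nabs (chi b * P b u * (binomial_series u (x b) - (1 + u * x b)))
        \<le> 1 * (nabs u * (m * real q)\<^sup>2)"
      unfolding nabs_mult[of "_ * _" "_ - _"]
      using b u by (intro mult_mono nabs_chi_angle_pow_le_1) auto
    then show "nabs (chi b * P b u * (binomial_series u (x b) - (1 + u * x b)))
        \<le> nabs u * (m * real q)\<^sup>2"
      by simp
  qed simp
  ultimately have "nabs ((chi c * P c u - 1) * W M u - u * (\<Sum>b\<in>units_upto M. H b u * of_int (k b)))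
      \<le> nabs u * (m * real q)\<^sup>2 / m"
    using m by (simp add: nabs_divide divide_right_mono flip: m_def)
  also have "\<dots> = nabs u * (m * (real q)\<^sup>2)"
    using m by (simp add: power2_eq_square)
  finally show ?thesis
    by (simp add: k_def m_def)
qed

lemma angle_uminus: "\<not> int p dvd b \<Longrightarrow> A (- b) = A b"
  by (simp add: angle_def teichmuller_uminus)

text \<open>In the pair b, M - b both terms have the leading factor chi(b) \<open>P b u\<close>,
  while 1/b + 1/(M - b) = M / (b (M - b)) and (1 - M/b)^u - 1 are O(M). Pairing counts each residue
  twice; the outer factor 2 pays for halving when p = 2. No factor |u| is required, as this sum
  enters multiplied by u.\<close>

lemma sum_H_approx:
  assumes M: "q dvd M" "f dvd M" "M > 0" and even: "even_character chi" and u: "u \<in> disc"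
  shows "nabs (\<Sum>b\<in>units_upto M. H b u) \<le> 2 * (nabs (of_nat M :: 'a) * max 1 (nabs u * real q))"
proof -
  define m where "m = nabs (of_nat M :: 'a)"
  have pM: "int p dvd int M"
    using p_dvd_multiple_q[OF M(1)] by simp
  have dvd: "int p dvd int M - b \<longleftrightarrow> int p dvd b" for b
    using dvd_diff[OF pM, of "int M - b"] dvd_diff[OF pM, of b] by auto
  have refl: "(\<Sum>b\<in>units_upto M. H b u) = (\<Sum>b\<in>units_upto M. H (int M - b) u)"
  proof (rule sum.reindex_bij_witness[of _ "\<lambda>b. int M - b" "\<lambda>b. int M - b"])
    fix b assume "b \<in> units_upto M"
    moreover from this have "b \<noteq> int M"
      using pM by (auto simp: units_upto_def)
    ultimately show "int M - b \<in> units_upto M" "int M - b \<in> units_upto M"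
      using dvd by (auto simp: units_upto_def)
  qed auto
  have pair: "nabs (H b u + H (int M - b) u) \<le> m * max 1 (nabs u * real q)" if b: "\<not> int p dvd b" for b
  proof -
    define y where "y = binomial_series u (of_int (int M) / of_int (- b))"
    have b': "\<not> int p dvd - b" "\<not> int p dvd int M - b"
      using b dvd by auto
    have nz: "b \<noteq> 0" "int M - b \<noteq> 0"
      using b b' by auto
    have nz': "(of_int b :: 'a) \<noteq> 0" "(of_int (int M - b) :: 'a) \<noteq> 0"
      using nz by (simp_all del: of_int_diff)
    have "chi (int M - b) = chi b"
    proof -
      have "chi (- b + int M) = chi (- b)"
        using M(2) by (intro chi_add_multiple) simp
      also have "\<dots> = chi (- 1) * chi b"
        using chi_mult[of "- 1" b] by simp
      finally show ?thesis
        using even by (simp add: even_character_def)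
    qed
    moreover have "P (int M - b) u = P b u * y"
      using angle_pow_add_multiple[OF b'(1), of "int M" u] M(1) u angle_uminus[OF b]
      by (simp add: y_def angle_pow_eq)
    ultimately have "H (int M - b) u = chi b * P b u * y / of_int (int M - b)"
      unfolding H_def by simp
    moreover have "H b u = chi b * P b u / of_int b"
      by (simp add: H_def)
    moreover have "(of_nat M :: 'a) = of_int (int M - b) + of_int b"
      by simp
    moreover have "z / e + z * y / d = z * ((y - 1) / d + (d + e) / (e * d))"
      if "e \<noteq> 0" "d \<noteq> 0" for z e d :: 'a
      using that by (simp add: field_simps)
    note this[OF nz']
    ultimately have "H b u + H (int M - b) u = chi b * P b u *
        ((y - 1) / of_int (int M - b) + of_nat M / (of_int b * of_int (int M - b)))"
      by (simp only:)
    also have "nabs \<dots> \<le> 1 * (m * max 1 (nabs u * real q))"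
      unfolding nabs_mult[of "_ * _" "_ + _"]
    proof (intro mult_mono nabs_add_le)
      have "nabs (of_int (int M) / of_int (- b) :: 'a) \<le> m"
        using nabs_multiple_quotient_le[OF b'(1), of M "int M"] by (simp add: m_def)
      moreover have "m \<le> 1 / real q"
        using nabs_of_nat_multiple[OF M(1)] by (simp add: m_def nabs_q)
      ultimately have "nabs (y - 1) \<le> nabs u * (m * real q)"
        unfolding y_def
        by (intro order_trans[OF nabs_binomial_series_minus_1[OF u]] mult_left_mono mult_right_mono) auto
      also have "\<dots> = m * (nabs u * real q)"
        by simp
      also have "\<dots> \<le> m * max 1 (nabs u * real q)"
        by (intro mult_left_mono) (auto simp: m_def)
      finally show "nabs ((y - 1) / of_int (int M - b)) \<le> m * max 1 (nabs u * real q)"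
        unfolding nabs_divide nabs_of_int_coprime[OF b'(2)] by simp
      have "m * 1 \<le> m * max 1 (nabs u * real q)"
        by (intro mult_left_mono) (auto simp: m_def)
      then show "nabs (of_nat M / (of_int b * of_int (int M - b)) :: 'a) \<le> m * max 1 (nabs u * real q)"
        unfolding nabs_divide nabs_mult nabs_of_int_coprime[OF b'(2)] nabs_of_int_coprime[OF b]
        by (simp add: m_def)
    qed (use b u nabs_chi_angle_pow_le_1 in auto)
    finally show ?thesis
      by simp
  qed
  have "2 * (\<Sum>b\<in>units_upto M. H b u) = (\<Sum>b\<in>units_upto M. H b u + H (int M - b) u)"
    unfolding sum.distrib using refl by simp
  also have "nabs \<dots> \<le> m * max 1 (nabs u * real q)"
    using pair not_dvd_units_upto by (intro nabs_sum_le) (auto simp: m_def)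
  finally have "nabs (2 :: 'a) * nabs (\<Sum>b\<in>units_upto M. H b u) \<le> m * max 1 (nabs u * real q)"
    by (simp add: nabs_mult)
  moreover have "nabs (2 :: 'a) \<ge> 1 / 2"
    using nabs_of_nat_ge[of 2] by simp
  then have "1 / 2 * nabs (\<Sum>b\<in>units_upto M. H b u) \<le> nabs (2 :: 'a) * nabs (\<Sum>b\<in>units_upto M. H b u)"
    by (intro mult_right_mono) auto
  ultimately show ?thesis
    by (simp add: m_def)
qed

end

subsection \<open>The limit formula\<close>

text \<open>Close to a nonzero limit the absolute value is constant, so the denominators are bounded
  below at once.\<close>

lemma tendsto_inverse_nonarch:
  assumes g: "(g \<longlongrightarrow> (l::'a::nonarch_complete_field)) F" and l: "l \<noteq> 0"
  shows "((\<lambda>x. inverse (g x)) \<longlongrightarrow> inverse l) F"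
proof (rule tendsto_from_nabs_le)
  have lim: "((\<lambda>x. nabs (g x - l)) \<longlongrightarrow> 0) F"
    using g by (simp add: tendsto_nabs_iff)
  then show "((\<lambda>x. nabs (g x - l) / (nabs l * nabs l)) \<longlongrightarrow> 0) F"
    by (rule tendsto_divide_zero)
  have "\<forall>\<^sub>F x in F. nabs (g x - l) < nabs l"
    using lim l by (intro order_tendstoD) (auto intro: nabs_pos)
  then show "\<forall>\<^sub>F x in F. nabs (inverse (g x) - inverse l) \<le> nabs (g x - l) / (nabs l * nabs l)"
  proof eventually_elim
    case (elim x)
    then have eq: "nabs (g x) = nabs l"
      by (rule nabs_eq_of_close)
    then have "g x \<noteq> 0"
      using l nabs_eq_0_iff by metis
    then have "inverse (g x) - inverse l = (l - g x) / (g x * l)"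
      using l by (simp add: field_simps)
    then show ?case
      using eq by (simp add: nabs_divide nabs_mult nabs_minus_commute[of l])
  qed
qed

context padic
begin

text \<open>The bound 2 is the size of 1/2 in the case p = 2.\<close>

lemma nabs_half_le: "nabs (of_int k / 2 :: 'a) \<le> 2"
proof -
  have "nabs (2 :: 'a) \<ge> 1 / 2"
    using nabs_of_nat_ge[of 2] by simp
  moreover have "nabs (of_int k :: 'a) \<le> 1"
    by (rule nabs_of_int_le_1)
  ultimately show ?thesis
    by (simp add: nabs_divide divide_le_eq)
qed

lemma of_rat_eps: "of_rat (eps b c M) = (of_int (c - 1) / 2 - of_int (carry c M b) :: 'a)"
  by (simp add: eps_def carry_def of_rat_diff of_rat_divide)

lemma nabs_eps_le: "nabs (of_rat (eps b c M) :: 'a) \<le> 2"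
  unfolding of_rat_eps
  using nabs_of_int_le_1[of "carry c M b", where 'a = 'a]
  by (intro nabs_diff_le nabs_half_le) auto

lemma p_power_tendsto_0: "(\<lambda>n. D * (1 / real p) ^ n) \<longlonglongrightarrow> 0"
  using p_ge_2 by (intro tendsto_mult_right_zero LIMSEQ_power_zero) auto

text \<open>The points 1 + p^n accumulate at 1; this is what makes limits at 1 unique.\<close>

lemma at_1_neq_bot: "at (1::'a) \<noteq> bot"
proof
  assume "at (1::'a) = bot"
  then have "eventually (\<lambda>_. False) (at (1::'a))"
    by simp
  then obtain d where d: "d > 0" "\<And>x::'a. x \<noteq> 1 \<Longrightarrow> dist x 1 < d \<Longrightarrow> False"
    by (auto simp: eventually_at)
  obtain n where "(1 / real p) ^ n < d"
    using real_arch_pow_inv[OF d(1), of "1 / real p"] p_ge_2 by auto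
  then show False
    using d(2)[of "1 + of_nat p ^ n"] p_ge_2 by (simp add: dist_nabs nabs_power nabs_p)
qed

lemma eventually_at_1_disc: "\<forall>\<^sub>F t in at (1::'a). t \<noteq> 1 \<and> nabs (1 - t) \<le> 1 \<and> t \<in> disc"
  unfolding eventually_at
proof (intro exI[of _ 1] conjI ballI impI)
  fix t :: 'a
  assume t: "t \<noteq> 1 \<and> dist t 1 < 1"
  then have le: "nabs (1 - t) \<le> 1"
    by (simp add: dist_nabs nabs_minus_commute[of 1])
  then have "nabs (1 - (1 - t)) \<le> 1"
    by (rule nabs_diff_le[rotated]) simp
  then have "nabs t \<le> 1"
    by simp
  then show "t \<noteq> 1" "nabs (1 - t) \<le> 1" "t \<in> disc"
    using t le qr_gt_1 by (auto simp: disc_def)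
qed simp

lemma angle_pow_tendsto_1:
  assumes "\<not> int p dvd c"
  shows "((\<lambda>t. P c (1 - t)) \<longlongrightarrow> 1) (at 1)"
proof (rule tendsto_from_nabs_le)
  show "((\<lambda>t::'a. nabs (t - 1)) \<longlongrightarrow> 0) (at 1)"
    using tendsto_ident_at[of "1::'a" UNIV] by (simp only: tendsto_nabs_iff)
  show "\<forall>\<^sub>F t in at 1. nabs (P c (1 - t) - 1) \<le> nabs (t - 1)"
    using eventually_at_1_disc
    by eventually_elim
      (use nabs_angle_pow_minus_1[OF assms disc_diff[OF disc_1]] nabs_minus_commute in metis)
qed

end

context padic_character
begin

text \<open>One admissible multiple. As q is a power of p, the moduli \<open>F0 * p ^ n\<close> are
  a tail of the moduli \<open>f * p ^ n\<close> of the theorem.\<close>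

definition F0 :: nat where "F0 = f * q"

lemma F0: "q dvd F0" "f dvd F0" "F0 > 0"
  using f_pos q_gt_1 by (auto simp: F0_def)

definition eps_sum :: "int \<Rightarrow> nat \<Rightarrow> 'a \<Rightarrow> 'a" where
  "eps_sum c M s = (\<Sum>b\<in>units_upto M. twist_inv p chi b * (of_rat (eps b c (int M)) / P b s))"

lemma eps_sum_eq:
  assumes "s \<in> disc"
  shows "eps_sum c M s = (\<Sum>b\<in>units_upto M. H b (1 - s) * of_rat (eps b c (int M)))"
  unfolding eps_sum_def
proof (intro sum.cong refl)
  fix b assume "b \<in> units_upto M"
  then have b: "\<not> int p dvd b"
    by (rule not_dvd_units_upto)
  then have "(of_int b :: 'a) \<noteq> 0"
    by auto
  moreover have *: "P b (1 - s) * P b s = of_int b / T b"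
    using angle_pow_add[OF b disc_diff[OF disc_1 assms] assms] by (simp add: angle_pow_1 angle_def)
  moreover have "T b \<noteq> 0"
    by (rule teichmuller_neq_0[OF b])
  moreover from calculation have "P b s \<noteq> 0"
    by auto
  ultimately have "P b (1 - s) / of_int b = inverse (T b) / P b s"
    by (simp add: field_simps)
  then show "twist_inv p chi b * (of_rat (eps b c (int M)) / P b s) = H b (1 - s) * of_rat (eps b c (int M))"
    by (simp add: twist_inv_def H_def flip: times_divide_eq_right)
qed

text \<open>The entries bound three errors: the one from the added constant (c - 1) / 2 (a factor 2
  from halving, another from \<open>sum_H_approx\<close>), the second-order one of
  \<open>carry_approx\<close>, and the Bernoulli one of \<open>W_G_approx\<close> with its division
  by \<open>F0\<close>. Only a bound R on |1 - s| enters.\<close>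

definition rate :: "real \<Rightarrow> real" where
  "rate R = max (max (4 * max 1 (R * real q)) ((real q)\<^sup>2)) (2 * real p / nabs (of_nat F0 :: 'a))"

lemma eps_sum_approx_W:
  assumes M: "q dvd M" "f dvd M" "M > 0" and c: "coprime c (int M)" "c > 1"
    and even: "even_character chi" and s: "s \<in> disc" and R: "nabs (1 - s) \<le> R"
  shows "nabs ((1 - s) * eps_sum c M s + (chi c * P c (1 - s) - 1) * W M (1 - s))
    \<le> nabs (1 - s) * (nabs (of_nat M :: 'a) * rate R)"
proof -
  define u where "u = 1 - s"
  define m where "m = nabs (of_nat M :: 'a)"
  have u: "u \<in> disc"
    unfolding u_def using disc_1 s by (rule disc_diff)
  have m: "m \<ge> 0"
    by (simp add: m_def)
  have "u * eps_sum c M s + (chi c * P c u - 1) * W M u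
      = u * (of_int (c - 1) / 2 * (\<Sum>b\<in>units_upto M. H b u)) +
        ((chi c * P c u - 1) * W M u - u * (\<Sum>b\<in>units_upto M. H b u * of_int (carry c (int M) b)))"
    unfolding eps_sum_eq[OF s] of_rat_eps u_def[symmetric] right_diff_distrib sum_subtractf
      sum_distrib_right[symmetric]
    by (simp only: mult.commute[of "sum _ _"]) simp
  also have "nabs \<dots> \<le> nabs u * (m * rate R)"
  proof (rule nabs_add_le)
    have "nabs (\<Sum>b\<in>units_upto M. H b u) \<le> 2 * (m * max 1 (nabs u * real q))"
      unfolding m_def using sum_H_approx[OF M even u] .
    also have "\<dots> \<le> 2 * (m * max 1 (R * real q))"
      using m R by (intro mult_left_mono max.mono mult_right_mono) (auto simp: u_def)
    finally have "nabs (u * (of_int (c - 1) / 2 * (\<Sum>b\<in>units_upto M. H b u)))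
        \<le> nabs u * (2 * (2 * (m * max 1 (R * real q))))"
      unfolding nabs_mult[of u] nabs_mult[of "_ / 2"]
      by (intro mult_left_mono mult_mono nabs_half_le) auto
    also have "\<dots> = nabs u * (m * (4 * max 1 (R * real q)))"
      by simp
    also have "\<dots> \<le> nabs u * (m * rate R)"
      using m by (intro mult_left_mono) (auto simp: rate_def)
    finally show "nabs (u * (of_int (c - 1) / 2 * (\<Sum>b\<in>units_upto M. H b u))) \<le> nabs u * (m * rate R)" .
    have "nabs u * (m * (real q)\<^sup>2) \<le> nabs u * (m * rate R)"
      using m by (intro mult_left_mono) (auto simp: rate_def)
    then show "nabs ((chi c * P c u - 1) * W M u - u * (\<Sum>b\<in>units_upto M. H b u * of_int (carry c (int M) b)))
        \<le> nabs u * (m * rate R)"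
      using carry_approx[OF M c u] by (simp add: m_def)
  qed
  finally show ?thesis
    by (simp add: u_def m_def)
qed

text \<open>The left side of the theorem with the explicit formula for one fixed multiple in place
  of \<open>padic_L\<close>. At t = 1 the formula divides by zero and yields 0, so only values away
  from 1 and the limit at 1 are of interest.\<close>

definition Lval :: "int \<Rightarrow> 'a \<Rightarrow> 'a" where
  "Lval c t = - (1 - chi c * P c (1 - t)) * padic_L_formula p chi F0 t"

text \<open>Both the passage from sums to W and the one from W to G have errors with a factor |u|,
  which cancels on division by u; the Euler factor enters only through a multiplier of size at most
  1. With n > 0, p divides the number p^n of shifts.\<close>

lemma eps_sum_approx:
  assumes c: "coprime c (int (p * f))" "c > 1"
    and even: "even_character chi" and s: "s \<in> disc" "s \<noteq> 1" and R: "nabs (1 - s) \<le> R" and n: "n > 0"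
  shows "nabs (eps_sum c (F0 * p ^ n) s - Lval c s) \<le> rate R * (1 / real p) ^ n"
proof -
  define u where "u = 1 - s"
  define M where "M = F0 * p ^ n"
  define X where "X = chi c * P c u - 1"
  have u: "u \<in> disc" "u \<noteq> 0"
    unfolding u_def using disc_1 s by (auto intro: disc_diff)
  have M: "q dvd M" "f dvd M" "M > 0"
    using F0 p_ge_2 by (auto simp: M_def)
  have cp: "coprime c (int p)" "coprime c (int f)"
    using c(1) by auto
  have "coprime c (int q)"
    using q_power cp(1) by (metis coprime_power_right_iff of_nat_power)
  then have cM: "coprime c (int M)"
    using cp by (simp add: M_def F0_def)
  have pc: "\<not> int p dvd c"
    using cp(1) by (rule not_dvd_of_coprime)
  have N: "nabs (of_nat (p ^ n) :: 'a) = (1 / real p) ^ n"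
    by (simp add: nabs_power nabs_p)
  have "nabs (of_nat M :: 'a) \<le> 1 * (1 / real p) ^ n"
    unfolding M_def of_nat_mult nabs_mult N by (intro mult_right_mono nabs_of_nat_le_1) auto
  then have le_M: "nabs (of_nat M :: 'a) * rate R \<le> rate R * (1 / real p) ^ n"
    unfolding mult.commute[of _ "rate R"]
    by (intro mult_left_mono) (auto simp: rate_def le_max_iff_disj)
  have "nabs (u * eps_sum c M s + X * W M u) \<le> nabs u * (nabs (of_nat M :: 'a) * rate R)"
    unfolding u_def X_def by (rule eps_sum_approx_W[OF M cM c(2) even s(1) R])
  also have "\<dots> \<le> nabs u * (rate R * (1 / real p) ^ n)"
    using le_M by (rule mult_left_mono) simp
  finally have 1: "nabs (u * eps_sum c M s + X * W M u) \<le> nabs u * (rate R * (1 / real p) ^ n)" .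
  have "nabs (W M u - G F0 u) \<le> nabs u * (real p * (2 * (1 / real p) ^ n)) / nabs (of_nat F0 :: 'a)"
    using W_G_approx[OF F0, of "p ^ n" u] n p_ge_2 u unfolding M_def N by simp
  also have "\<dots> = nabs u * (2 * real p / nabs (of_nat F0 :: 'a) * (1 / real p) ^ n)"
    by simp
  also have "\<dots> \<le> nabs u * (rate R * (1 / real p) ^ n)"
    by (intro mult_left_mono mult_right_mono) (auto simp: rate_def)
  finally have WG: "nabs (W M u - G F0 u) \<le> nabs u * (rate R * (1 / real p) ^ n)" .
  have "nabs X \<le> 1"
    unfolding X_def using pc u by (intro nabs_diff_le nabs_chi_angle_pow_le_1) auto
  then have "nabs (X * (W M u - G F0 u)) \<le> 1 * (nabs u * (rate R * (1 / real p) ^ n))"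
    unfolding nabs_mult using WG by (intro mult_mono) auto
  from nabs_diff_le[OF 1 this[simplified]]
  have "nabs (u * eps_sum c M s + X * G F0 u) \<le> nabs u * (rate R * (1 / real p) ^ n)"
    by (simp add: algebra_simps)
  also have "u * eps_sum c M s + X * G F0 u = u * (eps_sum c M s - Lval c s)"
  proof -
    have "s - 1 = - u"
      by (simp add: u_def)
    then have "Lval c s = - (X * G F0 u / u)"
      by (simp add: Lval_def padic_L_formula_eq X_def flip: u_def)
    then show ?thesis
      using u(2) by (simp add: field_simps)
  qed
  finally have "nabs u * nabs (eps_sum c M s - Lval c s) \<le> nabs u * (rate R * (1 / real p) ^ n)"
    by (simp only: nabs_mult)
  then show ?thesis
    using nabs_pos[OF u(2)] by (simp add: M_def)
qed

text \<open>Continuity at s = 1 uniformly in M: each summand moves by at most 2 |1 - s|, the 2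
  bounding epsilon, and ultrametrically the number of summands does not matter.\<close>

lemma eps_sum_close:
  assumes s: "s \<in> disc"
  shows "nabs (eps_sum c M s - eps_sum c M 1) \<le> 2 * nabs (1 - s)"
proof -
  have u: "1 - s \<in> disc"
    using disc_1 s by (rule disc_diff)
  have "eps_sum c M s - eps_sum c M 1
      = (\<Sum>b\<in>units_upto M. (H b (1 - s) - H b 0) * of_rat (eps b c (int M)))"
    unfolding eps_sum_eq[OF s] eps_sum_eq[OF disc_1] by (simp add: sum_subtractf left_diff_distrib)
  also have "nabs \<dots> \<le> 2 * nabs (1 - s)"
  proof (rule nabs_sum_le)
    fix b assume "b \<in> units_upto M"
    then have b: "\<not> int p dvd b"
      by (rule not_dvd_units_upto)
    have "H b (1 - s) - H b 0 = chi b * (P b (1 - s) - 1) / of_int b"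
      by (simp add: H_def angle_pow_0 right_diff_distrib diff_divide_distrib)
    then have "nabs (H b (1 - s) - H b 0) = nabs (chi b) * nabs (P b (1 - s) - 1)"
      by (simp add: nabs_divide nabs_mult nabs_of_int_coprime[OF b])
    also have "\<dots> \<le> 1 * nabs (1 - s)"
      using b u by (intro mult_mono nabs_chi_le_1 nabs_angle_pow_minus_1) auto
    finally have "nabs ((H b (1 - s) - H b 0) * of_rat (eps b c (int M))) \<le> nabs (1 - s) * 2"
      unfolding nabs_mult[of "_ - _"] by (intro mult_mono nabs_eps_le) auto
    then show "nabs ((H b (1 - s) - H b 0) * of_rat (eps b c (int M))) \<le> 2 * nabs (1 - s)"
      by (simp add: mult.commute)
  qed simp
  finally show ?thesis .
qed

lemma eps_sum_limit_iff:
  "(\<lambda>n. eps_sum c (f * p ^ n) s) \<longlonglongrightarrow> l \<longleftrightarrow> (\<lambda>n. eps_sum c (F0 * p ^ n) s) \<longlonglongrightarrow> l"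
proof -
  obtain e where "q = p ^ e"
    by (rule q_power)
  then have "F0 * p ^ n = f * p ^ (n + e)" for n
    by (simp add: F0_def power_add)
  then have eq: "(\<lambda>n. eps_sum c (F0 * p ^ n) s) = (\<lambda>n. eps_sum c (f * p ^ (n + e)) s)"
    by simp
  show ?thesis
    unfolding eq
    using LIMSEQ_ignore_initial_segment[of "\<lambda>n. eps_sum c (f * p ^ n) s" l e]
      LIMSEQ_offset[of "\<lambda>n. eps_sum c (f * p ^ n) s" e l] by blast
qed

lemma eps_sum_limit:
  assumes c: "coprime c (int (p * f))" "c > 1"
    and even: "even_character chi" and s: "s \<in> disc" "s \<noteq> 1"
  shows "(\<lambda>n. eps_sum c (f * p ^ n) s) \<longlonglongrightarrow> Lval c s"
  unfolding eps_sum_limit_iff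
proof (rule tendsto_from_nabs_le[OF _ p_power_tendsto_0])
  show "\<forall>\<^sub>F n in sequentially. nabs (eps_sum c (F0 * p ^ n) s - Lval c s)
      \<le> rate (nabs (1 - s)) * (1 / real p) ^ n"
    using eventually_gt_at_top[of 0]
    by eventually_elim (use eps_sum_approx[OF c even s order_refl] in blast)
qed

text \<open>The estimate cannot be divided by u = 0. Instead the sums at 1 are compared with those
  at a nearby t, and these with \<open>Lval c t\<close>. Both errors are uniform, which makes the
  sums at 1 a Cauchy sequence and its limit the limit of \<open>Lval c\<close>.\<close>

lemma eps_sum_limit_at_1:
  assumes c: "coprime c (int (p * f))" "c > 1" and even: "even_character chi"
  obtains l where "(\<lambda>n. eps_sum c (f * p ^ n) 1) \<longlonglongrightarrow> l" and "(Lval c \<longlongrightarrow> l) (at 1)"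
proof -
  define X where "X n = eps_sum c (F0 * p ^ n) 1" for n
  define D where "D = max 2 (rate 1)"
  have close: "nabs (X n - Lval c t) \<le> max (2 * nabs (1 - t)) (D * (1 / real p) ^ n)"
    if t: "t \<noteq> 1" "nabs (1 - t) \<le> 1" "t \<in> disc" and n: "n > 0" for t n
  proof (rule nabs_diff_le_trans)
    show "nabs (X n - eps_sum c (F0 * p ^ n) t) \<le> max (2 * nabs (1 - t)) (D * (1 / real p) ^ n)"
      using eps_sum_close[OF t(3), of c "F0 * p ^ n"] by (subst nabs_minus_commute) (simp add: X_def)
    have "rate 1 * (1 / real p) ^ n \<le> D * (1 / real p) ^ n"
      by (intro mult_right_mono) (auto simp: D_def)
    then show "nabs (eps_sum c (F0 * p ^ n) t - Lval c t) \<le> max (2 * nabs (1 - t)) (D * (1 / real p) ^ n)"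
      using eps_sum_approx[OF c even t(3) t(1) t(2) n] by linarith
  qed
  have diff: "nabs (X (Suc n) - X n) \<le> D * (1 / real p) ^ n" if n: "n > 0" for n
  proof -
    \<comment> \<open>This point balances the two errors in \<open>close\<close>: its distance from
      1 is exactly p^(-n).\<close>
    define t where "t = (1 - of_nat p ^ n :: 'a)"
    have nt: "nabs (1 - t) = (1 / real p) ^ n"
      by (simp add: t_def nabs_power nabs_p)
    have "nabs t \<le> 1"
      unfolding t_def by (intro nabs_diff_le) (use nabs_of_nat_le_1[of "p ^ n"] in auto)
    then have "t \<in> disc"
      using qr_gt_1 by (simp add: disc_def)
    moreover have "(1 / real p) ^ n \<le> 1"
      using p_ge_2 by (intro power_le_one) auto
    moreover have "t \<noteq> 1"
      using p_ge_2 by (simp add: t_def)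
    ultimately have t: "t \<noteq> 1" "nabs (1 - t) \<le> 1" "t \<in> disc"
      using nt by auto
    have "2 * (1 / real p) ^ n \<le> D * (1 / real p) ^ n"
      by (intro mult_right_mono) (auto simp: D_def)
    moreover have "D * (1 / real p) ^ Suc n \<le> D * (1 / real p) ^ n"
      using p_ge_2 by (intro mult_left_mono power_decreasing) (auto simp: D_def)
    ultimately have "nabs (X (Suc n) - Lval c t) \<le> D * (1 / real p) ^ n"
      "nabs (Lval c t - X n) \<le> D * (1 / real p) ^ n"
      using close[OF t n] close[OF t, of "Suc n"] nabs_minus_commute[of "Lval c t" "X n"]
      unfolding nt by linarith+
    then show ?thesis
      by (rule nabs_diff_le_trans)
  qed
  have "(\<lambda>n. X (Suc n) - X n) \<longlonglongrightarrow> 0"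
  proof (rule tendsto_from_nabs_le[OF _ p_power_tendsto_0])
    show "\<forall>\<^sub>F n in sequentially. nabs (X (Suc n) - X n - 0) \<le> D * (1 / real p) ^ n"
      using eventually_gt_at_top[of 0] by eventually_elim (use diff in simp)
  qed
  then obtain l where l: "X \<longlonglongrightarrow> l"
    using convergent_of_differences unfolding convergent_def by blast
  have "(Lval c \<longlongrightarrow> l) (at 1)"
  proof (rule tendsto_from_nabs_le)
    show "((\<lambda>t::'a. 2 * nabs (t - 1)) \<longlongrightarrow> 0) (at 1)"
      using tendsto_ident_at[of "1::'a" UNIV] unfolding tendsto_nabs_iff
      by (rule tendsto_mult_right_zero)
    show "\<forall>\<^sub>F t in at 1. nabs (Lval c t - l) \<le> 2 * nabs (t - 1)"
      using eventually_at_1_disc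
    proof eventually_elim
      case (elim t)
      \<comment> \<open>With t fixed, the error depending on n eventually drops below the other one,
        so letting n grow leaves only the distance from t to 1.\<close>
      have "nabs (1 - t) > 0"
        using elim by (intro nabs_pos) auto
      then have "\<forall>\<^sub>F n in sequentially. D * (1 / real p) ^ n < 2 * nabs (1 - t)"
        using p_power_tendsto_0 by (intro order_tendstoD) auto
      then have "\<forall>\<^sub>F n in sequentially. nabs (X n - Lval c t) \<le> 2 * nabs (1 - t)"
        using eventually_gt_at_top[of 0]
      proof eventually_elim
        case (elim n)
        then show ?case
          using close[OF _ _ _ elim(2), of t] \<open>t \<noteq> 1 \<and> nabs (1 - t) \<le> 1 \<and> t \<in> disc\<close> by simp
      qed
      moreover have "(\<lambda>n. X n - Lval c t) \<longlonglongrightarrow> l - Lval c t"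
        using l by (intro tendsto_diff tendsto_const)
      ultimately have "nabs (l - Lval c t) \<le> 2 * nabs (1 - t)"
        by (intro nabs_limit_le) auto
      then show ?case
        using nabs_minus_commute[of l "Lval c t"] nabs_minus_commute[of 1 t] by simp
    qed
  qed
  moreover have "(\<lambda>n. eps_sum c (f * p ^ n) 1) \<longlonglongrightarrow> l"
    unfolding eps_sum_limit_iff using l by (simp only: X_def[abs_def])
  ultimately show ?thesis
    by (rule that[rotated])
qed

section \<open>From the explicit formula to the L-function, including its value at 1\<close>

lemma padic_L_formula_independent:
  assumes "q dvd F" "f dvd F" "F > 0" "t \<in> disc"
  shows "padic_L_formula p chi F t = padic_L_formula p chi F0 t"
  unfolding padic_L_formula_eq
  using G_independent[OF assms(1-3) F0 disc_diff[OF disc_1 assms(4)]] by simp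

lemma padic_L_eq:
  assumes "s \<in> disc" "s \<noteq> 1"
  shows "padic_L p f chi s = padic_L_formula p chi F0 s"
  unfolding padic_L_def
proof (rule the_equality)
  fix y
  assume "\<forall>F. F > 0 \<and> q dvd F \<and> f dvd F \<longrightarrow>
    (if s = 1 then (padic_L_formula p chi F \<longlongrightarrow> y) (at 1) else y = padic_L_formula p chi F s)"
  then show "y = padic_L_formula p chi F0 s"
    using F0 assms by simp
qed (use padic_L_formula_independent assms in auto)

lemma padic_L_eq_limit:
  assumes "(padic_L_formula p chi F0 \<longlongrightarrow> y) (at 1)"
  shows "padic_L p f chi 1 = y"
  unfolding padic_L_def
proof (rule the_equality)
  have "(padic_L_formula p chi F \<longlongrightarrow> y) (at 1)" if "q dvd F" "f dvd F" "F > 0" for F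
  proof (rule Lim_transform_eventually[OF assms])
    show "\<forall>\<^sub>F t in at 1. padic_L_formula p chi F0 t = padic_L_formula p chi F t"
      using eventually_at_1_disc
      by eventually_elim (use padic_L_formula_independent that in simp)
  qed
  then show "\<forall>F. F > 0 \<and> q dvd F \<and> f dvd F \<longrightarrow>
    (if (1::'a) = 1 then (padic_L_formula p chi F \<longlongrightarrow> y) (at 1) else y = padic_L_formula p chi F 1)"
    by simp
  fix z
  assume "\<forall>F. F > 0 \<and> q dvd F \<and> f dvd F \<longrightarrow>
    (if (1::'a) = 1 then (padic_L_formula p chi F \<longlongrightarrow> z) (at 1) else z = padic_L_formula p chi F 1)"
  then have "(padic_L_formula p chi F0 \<longlongrightarrow> z) (at 1)"
    using F0 by simp
  then show "z = y"
    using assms by (rule tendsto_unique[OF at_1_neq_bot])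
qed

text \<open>Primitivity for the divisor 1 of f gives a unit modulo f with value other than 1. If p
  divides it, then p does not divide f, and adding f makes it prime to p.\<close>

lemma exists_nontrivial_value:
  assumes "chi \<noteq> (\<lambda>_. 1)"
  obtains c where "coprime c (int (p * f))" "c > 1" "chi c \<noteq> 1"
proof -
  have "f \<noteq> 1"
  proof
    assume "f = 1"
    then have "chi a = 1" for a
      using chi_add_multiple[of "a - 1" 1] chi_1 by simp
    then show False
      using assms by auto
  qed
  then have "1 dvd f \<and> 1 < f"
    using f_pos by simp
  then obtain a where a: "coprime a (int f)" "chi a \<noteq> 1"
    using primitive unfolding primitive_dirichlet_character_def by blast
  obtain b where b: "coprime b (int f)" "chi b \<noteq> 1" "coprime b (int p)"
  proof (cases "int p dvd a")
    case False
    then have "coprime (int p) a"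
      using prime_p by (simp add: prime_imp_coprime)
    then show ?thesis
      using a that[of a] by (simp add: coprime_commute)
  next
    case True
    have "\<not> int p dvd int f"
      using True a(1) prime_p by (metis coprime_common_divisor not_prime_unit prime_nat_int_transfer)
    then have "\<not> int p dvd a + int f"
      using True by (simp add: dvd_add_right_iff)
    then have "coprime (int p) (a + int f)"
      using prime_p by (simp add: prime_imp_coprime)
    moreover have "chi (a + int f) = chi a"
      by (rule chi_add_multiple) simp
    moreover have "coprime (a + int f) (int f)"
      using a(1) by (simp only: coprime_iff_gcd_eq_1 gcd_add1)
    ultimately show ?thesis
      using a that[of "a + int f"] by (simp add: coprime_commute)
  qed
  \<comment> \<open>The multiple of p f is chosen large enough that c is at least b + |b| + 2, hence
    above 1.\<close>
  define c where "c = b + (\<bar>b\<bar> + 2) * int (p * f)"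
  have "p * f > 0"
    using f_pos p_ge_2 by simp
  then have "1 \<le> int (p * f)"
    by linarith
  then have "(\<bar>b\<bar> + 2) * 1 \<le> (\<bar>b\<bar> + 2) * int (p * f)"
    by (intro mult_left_mono) auto
  then have "c > 1"
    using abs_ge_minus_self[of b] unfolding c_def mult_1_right by linarith
  moreover have "coprime c (int (p * f))"
  proof -
    have "gcd (int (p * f)) ((\<bar>b\<bar> + 2) * int (p * f) + b) = gcd (int (p * f)) b"
      by (rule gcd_add_mult)
    moreover have "coprime (int (p * f)) b"
      using b by (simp add: coprime_commute)
    ultimately have "coprime (int (p * f)) c"
      by (simp only: c_def coprime_iff_gcd_eq_1 add.commute)
    then show ?thesis
      by (subst coprime_commute)
  qed
  moreover have "chi c = chi b"
    unfolding c_def by (rule chi_add_multiple) simp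
  ultimately show ?thesis
    using b(2) that by metis
qed

lemma coprime_not_dvd:
  assumes "coprime c (int (p * f))"
  shows "\<not> int p dvd c"
  using assms by (intro not_dvd_of_coprime) simp

lemma euler_factor_tendsto:
  assumes "coprime c (int (p * f))"
  shows "((\<lambda>t. - (1 - chi c * P c (1 - t))) \<longlongrightarrow> - (1 - chi c)) (at 1)"
proof -
  have "((\<lambda>t. - (1 - chi c * P c (1 - t))) \<longlongrightarrow> - (1 - chi c * 1)) (at 1)"
    by (intro tendsto_minus tendsto_diff tendsto_mult tendsto_const angle_pow_tendsto_1
        coprime_not_dvd[OF assms])
  then show ?thesis
    by simp
qed

text \<open>
  The formula for the L-function has a limit at 1 because it is the quotient of the limit function
  for an auxiliary \<open>c\<close> by the Euler factor at \<open>c\<close>, which does not vanish if \<open>chi c \<noteq> 1\<close>.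
\<close>

lemma padic_L_formula_limit_at_1:
  assumes "chi \<noteq> (\<lambda>_. 1)" and even: "even_character chi"
  obtains y where "(padic_L_formula p chi F0 \<longlongrightarrow> y) (at 1)"
proof -
  obtain c where c: "coprime c (int (p * f))" "c > 1" "chi c \<noteq> 1"
    using assms(1) by (rule exists_nontrivial_value)
  obtain l where l: "(Lval c \<longlongrightarrow> l) (at 1)"
    using eps_sum_limit_at_1[OF c(1,2) even] by blast
  define E where "E t = - (1 - chi c * P c (1 - t))" for t
  have nz: "- (1 - chi c) \<noteq> 0"
    using c(3) by simp
  have E: "(E \<longlongrightarrow> - (1 - chi c)) (at 1)"
    unfolding E_def by (rule euler_factor_tendsto[OF c(1)])
  have lim: "((\<lambda>t. inverse (E t) * Lval c t) \<longlongrightarrow> inverse (- (1 - chi c)) * l) (at 1)"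
    by (intro tendsto_mult tendsto_inverse_nonarch E nz l)
  have "\<forall>\<^sub>F t in at 1. E t \<noteq> 0"
    using tendsto_imp_eventually_ne[OF E nz] .
  moreover have "Lval c t = E t * padic_L_formula p chi F0 t" for t
    by (simp only: Lval_def E_def)
  ultimately have "\<forall>\<^sub>F t in at 1. inverse (E t) * Lval c t = padic_L_formula p chi F0 t"
    by (auto elim!: eventually_mono)
  then show ?thesis
    using Lim_transform_eventually[OF lim] that by blast
qed

end

theorem corollary2p5:
  fixes p f :: nat and c :: int
    and chi :: "int \<Rightarrow> 'a::nonarch_complete_field" and s :: 'a
  assumes "prime p"
    and "complex_padic p TYPE('a)"
    and "primitive_dirichlet_character f chi"
    and "even_character chi"
    and "c > 1"
    and "coprime c (int (p * f))"
    and "nabs s < real (qq p) * real p powr (- 1 / (real p - 1))"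
  shows "let L = (\<lambda>t. - (1 - chi c * angle_pow p c (1 - t)) * padic_L p f chi t);
             S = (\<lambda>n. \<Sum>a | 1 \<le> a \<and> a \<le> int (f * p ^ n) \<and> \<not> int p dvd a.
                    twist_inv p chi a * (of_rat (eps a c (int (f * p ^ n))) / angle_pow p a s))
         in if chi = (\<lambda>_. 1) \<and> s = 1
            \<comment> \<open>the pole of the L-function is cancelled: the product is read as its continuation to 1\<close>
            then \<exists>l. (L \<longlongrightarrow> l) (at 1) \<and> S \<longlonglongrightarrow> l
            else S \<longlonglongrightarrow> L s"
proof -
  interpret padic_character p "TYPE('a)" f chi
    using assms(1-3) by unfold_locales (auto simp: complex_padic_def)
  define L where "L t = - (1 - chi c * P c (1 - t)) * padic_L p f chi t" for t
  have S: "(\<Sum>a | 1 \<le> a \<and> a \<le> int (f * p ^ n) \<and> \<not> int p dvd a.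
      twist_inv p chi a * (of_rat (eps a c (int (f * p ^ n))) / P a s)) = eps_sum c (f * p ^ n) s" for n
    by (simp add: eps_sum_def units_upto_def)
  have s: "s \<in> disc"
    using assms(7) by (simp add: disc_def fact_radius_def)
  have L_eq: "L t = Lval c t" if "t \<in> disc" "t \<noteq> 1" for t
    using that by (simp add: L_def Lval_def padic_L_eq)
  have main: "if chi = (\<lambda>_. 1) \<and> s = 1
      then \<exists>l. (L \<longlongrightarrow> l) (at 1) \<and> (\<lambda>n. eps_sum c (f * p ^ n) s) \<longlonglongrightarrow> l
      else (\<lambda>n. eps_sum c (f * p ^ n) s) \<longlonglongrightarrow> L s"
  proof (cases "s = 1")
    case False
    then show ?thesis
      using eps_sum_limit[OF assms(6,5,4) s] L_eq s by simp
  next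
    case True
    obtain l where l: "(\<lambda>n. eps_sum c (f * p ^ n) 1) \<longlonglongrightarrow> l" "(Lval c \<longlongrightarrow> l) (at 1)"
      using eps_sum_limit_at_1[OF assms(6,5,4)] by blast
    show ?thesis
    proof (cases "chi = (\<lambda>_. 1)")
      case triv: True
      have "(L \<longlongrightarrow> l) (at 1)"
      proof (rule Lim_transform_eventually[OF l(2)])
        show "\<forall>\<^sub>F t in at 1. Lval c t = L t"
          using eventually_at_1_disc by eventually_elim (simp add: L_eq)
      qed
      then show ?thesis
        using l(1) True triv by auto
    next
      case nontriv: False
      \<comment> \<open>For the given c the value chi(c) may be 1, so its product does not determine
        y; the limit of the formula is known independently of c, and only then multiplied by the
        Euler factor.\<close>
      obtain y where y: "(padic_L_formula p chi F0 \<longlongrightarrow> y) (at 1)"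
        using padic_L_formula_limit_at_1[OF nontriv assms(4)] by blast
      have "(Lval c \<longlongrightarrow> - (1 - chi c) * y) (at 1)"
        unfolding Lval_def by (intro tendsto_mult euler_factor_tendsto assms(6) y)
      then have "l = - (1 - chi c) * y"
        by (rule tendsto_unique[OF at_1_neq_bot l(2)])
      then have "l = L 1"
        by (simp add: L_def padic_L_eq_limit[OF y] angle_pow_0)
      then show ?thesis
        using l(1) True nontriv by simp
    qed
  qed
  show ?thesis
    unfolding Let_def S using main by (simp only: L_def[abs_def])
qed

end
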